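(* Let $PG_n$ be the random pentagonal chain network described in the context, and assume Hypotheses 1 and 2 of the context hold. Then: (i) For $n\ge 1$, $$Var\big(Kf^{+}(PG_{n})\big)=\frac{1}{30}\Big(\sigma^{2}_{4}n^{5}-5r_{4}n^{4}+10\tilde{\sigma}^{2}_{4}n^{3}+(65r_{4}-30\sigma^{2}_{4}-45\tilde{\sigma}^{2}_{4})n^{2}+(59\sigma^{2}_{4}+65\tilde{\sigma}^{2}_{4}-120r_{4})n+(60r_{4}-30\sigma^{2}_{4}-30\tilde{\sigma}^{2}_{4})\Big),$$ where $\sigma^{2}_{4}=216^{2}p_{1}+264^{2}(1-p_{1})-\big(216p_{1}+264(1-p_{1})\big)^{2}$, $\tilde{\sigma}^{2}_{4}=133^{2}p_{1}+181^{2}(1-p_{1})-\big(133p_{1}+181(1-p_{1})\big)^{2}$, $r_{4}=216\cdot133\,p_{1}+264\cdot181\,(1-p_{1})-\big(216p_{1}+264(1-p_{1})\big)\big(133p_{1}+181(1-p_{1})\big)$. (ii) $Kf^{+}(PG_n)$ is asymptotically normal: $$\lim_{n\rightarrow \infty}\sup_{a\in \mathbb{R}}\Big| \mathbb{P}\Big(\frac{Kf^{+}(PG_{n})-\mathbb{E}\big(Kf^{+}(PG_{n})\big)}{\sqrt{Var\big(Kf^{+}(PG_{n})\big)}}\leq a\Big)-\int^{a}_{-\infty}\frac{1}{\sqrt{2\pi}}e^{-t^{2}/2}\,dt \Big| =0.$$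
   Context: Random chain network $PG_n$: $PG_1$ is a $5$-cycle (pentagon). For $n\ge 1$, $PG_{n+1}$ is obtained from $PG_n$ by adding a new pentagon $O_{n+1}$ with vertices $x_1,\dots,x_5$ in cyclic order and adding one edge joining $x_1$ to a vertex $u_n$ of $PG_n$. The vertex $u_1$ is any vertex of $PG_1$. For $n\ge 2$, $u_n$ is a vertex of the last pentagon $O_n$ (whose vertex $x_1$ is the one joined to $u_{n-1}$): either $u_n\in\{x_2,x_5\}$ of $O_n$ (neighbours of $x_1$ in $O_n$; set $Z_n^1=1$, $Z_n^2=0$) or $u_n\in\{x_3,x_4\}$ of $O_n$ (vertices at distance $2$ from $x_1$ in $O_n$; set $Z_n^1=0$, $Z_n^2=1$), with $\mathbb{P}(Z_n^1=1)=p_1$, $\mathbb{P}(Z_n^2=1)=p_2=1-p_1$, constants independent of $n$. Hypothesis 1: the random vectors $(Z_n^1,Z_n^2)$, $n=2,3,\dots$, are independent. Hypothesis 2: $0<p_i<1$ for $i=1,2$. For a graph $G$, $d(v)$ is the degree of $v$, $r(u,v)$ the resistance distance (effective resistance between $u$ and $v$ when every edge is a unit resistor), and the additive degree-Kirchhoff index is $Kf^{+}(G)=\sum_{\{u,v\}\subseteq V_G} \big(d(u)+d(v)\big)\,r(u,v)$ over unordered pairs of distinct vertices. *)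

theory Defs
  imports "HOL-Probability.Probability"
begin

section \<open>Generic graph notions (finite vertex set V, symmetric irreflexive adjacency E)\<close>

definition degree :: "'a set \<Rightarrow> ('a \<Rightarrow> 'a \<Rightarrow> bool) \<Rightarrow> 'a \<Rightarrow> nat" where
  "degree V E x = card {y \<in> V. E x y}"

text \<open>Resistance distance: effective resistance between u and v with unit resistors,
  i.e. potential difference phi u - phi v of a potential phi solving Kirchhoff's
  equations (graph Laplacian) for a unit current injected at u and extracted at v.\<close>
definition resistance :: "'a set \<Rightarrow> ('a \<Rightarrow> 'a \<Rightarrow> bool) \<Rightarrow> 'a \<Rightarrow> 'a \<Rightarrow> real" where
  "resistance V E u v = (THE r. \<exists>phi :: 'a \<Rightarrow> real.
      (\<forall>x\<in>V. (\<Sum>y\<in>{y \<in> V. E x y}. phi x - phi y)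
               = (if x = u then 1 else 0) - (if x = v then 1 else 0))
      \<and> r = phi u - phi v)"

text \<open>Additive degree-Kirchhoff index: sum over unordered pairs of distinct vertices,
  written as half the sum over ordered pairs.\<close>
definition kf_plus :: "'a set \<Rightarrow> ('a \<Rightarrow> 'a \<Rightarrow> bool) \<Rightarrow> real" where
  "kf_plus V E = (\<Sum>(u, v) \<in> {(u, v). u \<in> V \<and> v \<in> V \<and> u \<noteq> v}.
      (real (degree V E u) + real (degree V E v)) * resistance V E u v) / 2"

text \<open>Vertex (k, j) is vertex x_{j+1} of pentagon O_{k+1} (k < n, j < 5).
  cs ! k is the index j of the vertex u_{k+1} of O_{k+1} joined to x_1 = (k+1, 0) of O_{k+2}.\<close>
definition pg_vertices :: "nat \<Rightarrow> (nat \<times> nat) set" where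
  "pg_vertices n = {0..<n} \<times> {0..<5}"

definition pg_link :: "nat list \<Rightarrow> nat \<times> nat \<Rightarrow> nat \<times> nat \<Rightarrow> bool" where
  "pg_link cs a b = (fst b = Suc (fst a) \<and> snd b = 0 \<and> snd a = cs ! fst a)"

definition pg_adj :: "nat list \<Rightarrow> nat \<times> nat \<Rightarrow> nat \<times> nat \<Rightarrow> bool" where
  "pg_adj cs a b =
     ((fst a = fst b \<and> (snd b = Suc (snd a) mod 5 \<or> snd a = Suc (snd b) mod 5))
      \<or> pg_link cs a b \<or> pg_link cs b a)"

text \<open>Random choices u_2, ..., u_{m+1}: independent, u_k distributed by q k.\<close>
fun rand_choices :: "(nat \<Rightarrow> nat pmf) \<Rightarrow> nat \<Rightarrow> nat list pmf" where
  "rand_choices q 0 = return_pmf []"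
| "rand_choices q (Suc m) =
     bind_pmf (rand_choices q m) (\<lambda>xs. map_pmf (\<lambda>x. xs @ [x]) (q (m + 2)))"

text \<open>Distribution of the attachment list of PG_n: u_1 = c0 fixed, then u_2..u_{n-1} random.\<close>
definition pg_choices :: "nat \<Rightarrow> (nat \<Rightarrow> nat pmf) \<Rightarrow> nat \<Rightarrow> nat list pmf" where
  "pg_choices c0 q n = map_pmf (\<lambda>xs. c0 # xs) (rand_choices q (n - 2))"

definition kf_pg :: "nat \<Rightarrow> nat list \<Rightarrow> real" where
  "kf_pg n cs = kf_plus (pg_vertices n) (pg_adj cs)"

end

theory Submission
  imports Defs
begin

text \<open>
  A bridge is a resistor in series, so attaching a pentagon changes the index by an explicit
  expression in the resistance sums seen from the attachment vertex. Solving the resulting recursion,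
  the index of the chain is a deterministic polynomial in \<open>n\<close> plus the sum over \<open>2 \<le> k \<le> n - 1\<close> of
  \<open>120 (k - 1) (n - k) \<rho>(u\<^sub>k)\<close>, where \<open>\<rho>(u\<^sub>k)\<close> is the resistance between \<open>x\<^sub>1\<close> and \<open>u\<^sub>k\<close> inside
  the \<open>k\<close>-th pentagon, \<open>4/5\<close> or \<open>6/5\<close>. These are independent two-valued variables, so the variance is
  \<open>48\<^sup>2 p\<^sub>1 (1 - p\<^sub>1)\<close> times the sum of \<open>(k - 1)\<^sup>2 (n - k)\<^sup>2\<close>; the three constants of the theorem
  all equal \<open>48\<^sup>2 p\<^sub>1 (1 - p\<^sub>1)\<close>. After standardisation every summand is \<open>O(n\<^bsup>-1/2\<^esup>)\<close>, so the
  characteristic functions converge to the Gaussian one, and Polya's theorem upgrades the resulting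
  weak convergence to uniform convergence of the distribution functions.
\<close>

section \<open>Resistance across a bridge\<close>

definition laplacian :: "'a set \<Rightarrow> ('a \<Rightarrow> 'a \<Rightarrow> bool) \<Rightarrow> ('a \<Rightarrow> real) \<Rightarrow> 'a \<Rightarrow> real" where
  "laplacian V E phi x = (\<Sum>y\<in>{y \<in> V. E x y}. phi x - phi y)"

definition unit_potential :: "'a set \<Rightarrow> ('a \<Rightarrow> 'a \<Rightarrow> bool) \<Rightarrow> 'a \<Rightarrow> 'a \<Rightarrow> ('a \<Rightarrow> real) \<Rightarrow> bool" where
  "unit_potential V E u v phi \<longleftrightarrow>
     (\<forall>x\<in>V. laplacian V E phi x = (if x = u then 1 else 0) - (if x = v then 1 else 0))"

text \<open>Solvability of Kirchhoff's equations for every pair stands in for connectivity. In this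
  form it passes directly through bridges, so it can be carried along the induction that builds the
  chain.\<close>

definition resistive :: "'a set \<Rightarrow> ('a \<Rightarrow> 'a \<Rightarrow> bool) \<Rightarrow> bool" where
  "resistive V E \<longleftrightarrow> finite V \<and> symp_on V E \<and> (\<forall>u\<in>V. \<forall>v\<in>V. \<exists>phi. unit_potential V E u v phi)"

lemma laplacian_cong:
  "(\<And>y. y \<in> V \<Longrightarrow> phi y = psi y) \<Longrightarrow> x \<in> V \<Longrightarrow> laplacian V E phi x = laplacian V E psi x"
  unfolding laplacian_def by (rule sum.cong) auto

lemma laplacian_add_const: "laplacian V E (\<lambda>x. phi x + c) x = laplacian V E phi x"
  unfolding laplacian_def by simp

lemma laplacian_const: "laplacian V E (\<lambda>x. c) x = 0"
  unfolding laplacian_def by simp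

lemma laplacian_indicator:
  assumes "finite V"
  shows "laplacian V E phi x = (\<Sum>y\<in>V. of_bool (E x y) * (phi x - phi y))"
proof -
  have "laplacian V E phi x = (\<Sum>y\<in>V. if E x y then phi x - phi y else 0)"
    unfolding laplacian_def using assms by (simp add: sum.inter_filter)
  also have "\<dots> = (\<Sum>y\<in>V. of_bool (E x y) * (phi x - phi y))"
    by (rule sum.cong) auto
  finally show ?thesis .
qed

text \<open>The diagonal parts of both sides agree termwise; the off-diagonal parts are exchanged by
  swapping the two summation indices, because \<open>E\<close> is symmetric.\<close>

lemma laplacian_self_adjoint:
  assumes "finite V" "symp_on V E"
  shows "(\<Sum>x\<in>V. f x * laplacian V E g x) = (\<Sum>x\<in>V. g x * laplacian V E f x)"
proof -
  have sw: "(\<Sum>x\<in>V. \<Sum>y\<in>V. of_bool (E x y) * (f x * g y)) = (\<Sum>x\<in>V. \<Sum>y\<in>V. of_bool (E x y) * (g x * f y))"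
    by (subst sum.swap) (use assms(2) in \<open>auto intro!: sum.cong dest: symp_onD\<close>)
  have eq: "h x * laplacian V E k x =
      (\<Sum>y\<in>V. of_bool (E x y) * (h x * k x)) - (\<Sum>y\<in>V. of_bool (E x y) * (h x * k y))" for h k x
    by (simp add: laplacian_indicator[OF assms(1)] sum_distrib_left sum_subtractf[symmetric] algebra_simps)
  show ?thesis
    unfolding eq sum_subtractf using sw by (simp add: mult.commute)
qed

text \<open>The Laplacian of a unit potential is a difference of two point masses, so pairing with
  it evaluates \<open>f\<close> at the two terminals.\<close>

lemma unit_potential_pairing:
  assumes "finite V" "u \<in> V" "v \<in> V" "unit_potential V E u v phi"
  shows "(\<Sum>x\<in>V. f x * laplacian V E phi x) = f u - f v"
proof -
  have "(\<Sum>x\<in>V. f x * laplacian V E phi x) =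
      (\<Sum>x\<in>V. (if x = u then f x else 0) - (if x = v then f x else 0))"
    using assms(4) by (intro sum.cong) (auto simp: unit_potential_def)
  also have "\<dots> = f u - f v"
    using assms(1-3) by (simp add: sum_subtractf)
  finally show ?thesis .
qed

text \<open>Well-definedness needs no connectivity: pairing one potential with the Laplacian of another
  in both orders shows that they have the same drop between \<open>u\<close> and \<open>v\<close>.\<close>

lemma resistance_eqI:
  assumes "finite V" "symp_on V E" "u \<in> V" "v \<in> V" and phi: "unit_potential V E u v phi"
  shows "resistance V E u v = phi u - phi v"
  unfolding resistance_def
proof (rule the_equality)
  fix r :: real
  assume "\<exists>psi. (\<forall>x\<in>V. (\<Sum>y\<in>{y \<in> V. E x y}. psi x - psi y)
      = (if x = u then 1 else 0) - (if x = v then 1 else 0)) \<and> r = psi u - psi v"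
  then obtain psi where psi: "unit_potential V E u v psi" and r: "r = psi u - psi v"
    unfolding unit_potential_def laplacian_def by auto
  show "r = phi u - phi v"
    using laplacian_self_adjoint[OF assms(1,2), of phi psi] unit_potential_pairing[OF assms(1,3,4)] phi psi r
    by simp
next
  show "\<exists>psi. (\<forall>x\<in>V. (\<Sum>y\<in>{y \<in> V. E x y}. psi x - psi y)
      = (if x = u then 1 else 0) - (if x = v then 1 else 0)) \<and> phi u - phi v = psi u - psi v"
    using phi unfolding unit_potential_def laplacian_def by (intro exI[of _ phi] conjI refl)
qed

lemma resistance_self:
  assumes "finite V" "symp_on V E" "u \<in> V"
  shows "resistance V E u u = 0"
  using resistance_eqI[of V E u u "\<lambda>_. 0"] assms by (simp add: unit_potential_def laplacian_def)

lemma unit_potential_uminus: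
  "unit_potential V E u v phi \<Longrightarrow> unit_potential V E v u (\<lambda>x. - phi x)"
  unfolding unit_potential_def laplacian_def by (auto simp: sum_subtractf sum_negf)

lemma resistance_commute:
  assumes "resistive V E" "u \<in> V" "v \<in> V"
  shows "resistance V E u v = resistance V E v u"
proof -
  obtain phi where phi: "unit_potential V E u v phi"
    using assms unfolding resistive_def by blast
  show ?thesis
    using resistance_eqI[OF _ _ _ _ phi] resistance_eqI[OF _ _ _ _ unit_potential_uminus[OF phi]] assms
    by (simp add: resistive_def)
qed

section \<open>Two networks joined by a single edge\<close>

locale bridge =
  fixes A B :: "'a set" and E :: "'a \<Rightarrow> 'a \<Rightarrow> bool" and a b :: 'a
  assumes res_A: "resistive A E" and res_B: "resistive B E"
    and disjoint: "A \<inter> B = {}"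
    and a_in: "a \<in> A" and b_in: "b \<in> B"
    and across: "\<And>x y. x \<in> A \<Longrightarrow> y \<in> B \<Longrightarrow> E x y \<longleftrightarrow> x = a \<and> y = b"
    and across': "\<And>x y. x \<in> A \<Longrightarrow> y \<in> B \<Longrightarrow> E y x \<longleftrightarrow> x = a \<and> y = b"
begin

lemma finite_parts: "finite A" "finite B"
  using res_A res_B by (auto simp: resistive_def)

text \<open>The hypotheses are symmetric in the two sides, so every fact about \<open>A\<close>
  transfers to \<open>B\<close>; the primed lemmas below arise this way.\<close>

lemma swapped: "bridge B A E b a"
  using bridge_axioms unfolding bridge_def by (auto simp: Int_commute)

lemma sym_union: "symp_on (A \<union> B) E"
proof (rule symp_onI)
  fix x y assume "x \<in> A \<union> B" "y \<in> A \<union> B" "E x y"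
  then show "E y x"
    using res_A res_B across across' unfolding resistive_def
    by (metis UnE symp_onD)
qed

lemma laplacian_union:
  assumes "x \<in> A"
  shows "laplacian (A \<union> B) E phi x = laplacian A E phi x + (if x = a then phi a - phi b else 0)"
proof -
  have "(\<Sum>y\<in>B. of_bool (E x y) * (phi x - phi y)) = (\<Sum>y\<in>B. if y = b then (if x = a then phi a - phi b else 0) else 0)"
    using assms across by (intro sum.cong) auto
  also have "\<dots> = (if x = a then phi a - phi b else 0)"
    using finite_parts b_in by simp
  finally show ?thesis
    unfolding laplacian_indicator[OF finite_parts(1)]
      laplacian_indicator[OF finite_UnI[OF finite_parts]]
      sum.union_disjoint[OF finite_parts disjoint] by simp
qed

lemma laplacian_union':
  assumes "x \<in> B"
  shows "laplacian (A \<union> B) E phi x = laplacian B E phi x + (if x = b then phi b - phi a else 0)"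
  using bridge.laplacian_union[OF swapped assms] by (simp add: Un_commute)

text \<open>No current enters the side without terminals, so all of \<open>B\<close> sits at the
  potential of \<open>a\<close> and the bridge carries nothing.\<close>

lemma potential_within:
  assumes "u \<in> A" "v \<in> A" "unit_potential A E u v phi"
  shows "unit_potential (A \<union> B) E u v (\<lambda>x. if x \<in> A then phi x else phi a)"
    (is "unit_potential _ _ _ _ ?psi")
  unfolding unit_potential_def
proof
  fix x assume "x \<in> A \<union> B"
  then consider "x \<in> A" | "x \<in> B" "x \<notin> A" by blast
  then show "laplacian (A \<union> B) E ?psi x = (if x = u then 1 else 0) - (if x = v then 1 else 0)"
  proof cases
    case 1
    then show ?thesis
      using assms laplacian_cong[of A ?psi phi x] a_in b_in disjoint
      by (auto simp: laplacian_union unit_potential_def)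
  next
    case 2
    have "laplacian B E ?psi x = laplacian B E (\<lambda>_. phi a) x"
      using disjoint 2 by (intro laplacian_cong) auto
    then show ?thesis
      using assms 2 a_in b_in disjoint by (auto simp: laplacian_union' laplacian_const)
  qed
qed

text \<open>The whole unit current crosses the bridge. Hence \<open>a\<close> acts as the sink of
  \<open>A\<close>, \<open>b\<close> as the source of \<open>B\<close>, and the shift of
  \<open>psi\<close> puts \<open>b\<close> exactly one unit of potential below
  \<open>a\<close>.\<close>

lemma potential_across:
  assumes "u \<in> A" "v \<in> B" "unit_potential A E u a phi" "unit_potential B E b v psi"
  shows "unit_potential (A \<union> B) E u v (\<lambda>x. if x \<in> A then phi x else psi x + (phi a - psi b - 1))"
    (is "unit_potential _ _ _ _ ?chi")
  unfolding unit_potential_def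
proof
  fix x assume "x \<in> A \<union> B"
  then consider "x \<in> A" "x \<notin> B" | "x \<in> B" "x \<notin> A" using disjoint by blast
  then show "laplacian (A \<union> B) E ?chi x = (if x = u then 1 else 0) - (if x = v then 1 else 0)"
  proof cases
    case 1
    then show ?thesis
      using assms laplacian_cong[of A ?chi phi x] a_in b_in disjoint
      by (auto simp: laplacian_union unit_potential_def)
  next
    case 2
    have "laplacian B E ?chi x = laplacian B E (\<lambda>x. psi x + (phi a - psi b - 1)) x"
      using disjoint 2 by (intro laplacian_cong) auto
    then show ?thesis
      using assms 2 a_in b_in disjoint
      by (auto simp: laplacian_union' unit_potential_def laplacian_add_const)
  qed
qed

lemma resistance_within:
  assumes "u \<in> A" "v \<in> A"
  shows "resistance (A \<union> B) E u v = resistance A E u v"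
proof -
  obtain phi where phi: "unit_potential A E u v phi"
    using assms res_A unfolding resistive_def by blast
  show ?thesis
    using resistance_eqI[OF _ _ _ _ phi] resistance_eqI[OF _ sym_union _ _ potential_within[OF assms phi]]
      assms res_A res_B by (simp add: resistive_def)
qed

lemma resistance_within':
  assumes "u \<in> B" "v \<in> B"
  shows "resistance (A \<union> B) E u v = resistance B E u v"
  using bridge.resistance_within[OF swapped assms] by (simp add: Un_commute)

text \<open>Series law, read off from the glued potential; the summand 1 is the bridge
  itself.\<close>

lemma resistance_across:
  assumes "u \<in> A" "v \<in> B"
  shows "resistance (A \<union> B) E u v = resistance A E u a + 1 + resistance B E b v"
proof -
  obtain phi where phi: "unit_potential A E u a phi"
    using assms res_A a_in unfolding resistive_def by blast
  obtain psi where psi: "unit_potential B E b v psi"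
    using assms res_B b_in unfolding resistive_def by blast
  have "v \<notin> A" using assms disjoint by auto
  then show ?thesis
    using resistance_eqI[OF _ _ _ _ phi] resistance_eqI[OF _ _ _ _ psi]
      resistance_eqI[OF _ sym_union _ _ potential_across[OF assms phi psi]] assms res_A res_B a_in b_in
    by (simp add: resistive_def)
qed

lemma resistive_union: "resistive (A \<union> B) E"
proof -
  have within: "\<exists>phi. unit_potential (A \<union> B) E u v phi" if "u \<in> A" "v \<in> A" for u v
    using potential_within res_A that unfolding resistive_def by blast
  have within': "\<exists>phi. unit_potential (A \<union> B) E u v phi" if "u \<in> B" "v \<in> B" for u v
    using bridge.potential_within[OF swapped] res_B that unfolding resistive_def
    by (metis Un_commute)
  have btw: "\<exists>phi. unit_potential (A \<union> B) E u v phi" if "u \<in> A" "v \<in> B" for u v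
    using potential_across res_A res_B a_in b_in that unfolding resistive_def by blast
  have btw': "\<exists>phi. unit_potential (A \<union> B) E v u phi" if "u \<in> A" "v \<in> B" for u v
    using btw[OF that] by (blast intro: unit_potential_uminus)
  show ?thesis
    unfolding resistive_def using within within' btw btw' finite_parts sym_union by blast
qed

lemma degree_union:
  assumes "x \<in> A"
  shows "degree (A \<union> B) E x = degree A E x + of_bool (x = a)"
proof -
  have "{y \<in> A \<union> B. E x y} = {y \<in> A. E x y} \<union> {y \<in> B. E x y}" by auto
  then have "degree (A \<union> B) E x = degree A E x + card {y \<in> B. E x y}"
    unfolding degree_def using finite_parts disjoint by (simp, subst card_Un_disjoint) auto
  moreover have "{y \<in> B. E x y} = (if x = a then {b} else {})"
    using across[OF assms] b_in by auto
  ultimately show ?thesis by simp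
qed

lemma degree_union':
  assumes "x \<in> B"
  shows "degree (A \<union> B) E x = degree B E x + of_bool (x = b)"
  using bridge.degree_union[OF swapped assms] by (simp add: Un_commute)

end

section \<open>The additive degree-Kirchhoff index of a bridged union\<close>

definition res_sum :: "'a set \<Rightarrow> ('a \<Rightarrow> 'a \<Rightarrow> bool) \<Rightarrow> 'a \<Rightarrow> real" where
  "res_sum V E c = (\<Sum>v\<in>V. resistance V E v c)"

definition deg_res_sum :: "'a set \<Rightarrow> ('a \<Rightarrow> 'a \<Rightarrow> bool) \<Rightarrow> 'a \<Rightarrow> real" where
  "deg_res_sum V E c = (\<Sum>v\<in>V. real (degree V E v) * resistance V E v c)"

definition deg_sum :: "'a set \<Rightarrow> ('a \<Rightarrow> 'a \<Rightarrow> bool) \<Rightarrow> real" where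
  "deg_sum V E = (\<Sum>v\<in>V. real (degree V E v))"

lemma kf_plus_double_sum:
  assumes "finite V" "symp_on V E"
  shows "kf_plus V E = (\<Sum>u\<in>V. \<Sum>v\<in>V. (real (degree V E u) + real (degree V E v)) * resistance V E u v) / 2"
proof -
  have "(\<Sum>(u, v) \<in> {(u, v). u \<in> V \<and> v \<in> V \<and> u \<noteq> v}.
      (real (degree V E u) + real (degree V E v)) * resistance V E u v)
     = (\<Sum>(u, v) \<in> V \<times> V. (real (degree V E u) + real (degree V E v)) * resistance V E u v)"
    by (rule sum.mono_neutral_left) (use assms in \<open>auto simp: resistance_self\<close>)
  then show ?thesis
    unfolding kf_plus_def using assms by (simp add: sum.cartesian_product)
qed

context bridge
begin

lemma deg_sum_union: "deg_sum (A \<union> B) E = deg_sum A E + deg_sum B E + 2"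
  using finite_parts disjoint a_in b_in
  by (simp add: deg_sum_def sum.union_disjoint degree_union degree_union' sum.distrib
      of_bool_def if_distrib[of real] cong: if_cong)

lemma res_sum_union:
  assumes "c \<in> B"
  shows "res_sum (A \<union> B) E c = res_sum A E a + real (card A) * (1 + resistance B E b c) + res_sum B E c"
  using finite_parts disjoint assms
  by (simp add: res_sum_def sum.union_disjoint resistance_across resistance_within' sum.distrib algebra_simps)

text \<open>Relative to the separate parts, the degrees of \<open>a\<close> and \<open>b\<close>
  rise by one. This accounts for the 1 added to \<open>deg_sum A E\<close> and for the last
  summand.\<close>

lemma deg_res_sum_union:
  assumes "c \<in> B"
  shows "deg_res_sum (A \<union> B) E c = deg_res_sum A E a + (deg_sum A E + 1) * (1 + resistance B E b c)
      + deg_res_sum B E c + resistance B E b c"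
proof -
  have "(\<Sum>v\<in>A. real (degree (A \<union> B) E v) * resistance (A \<union> B) E v c)
     = (\<Sum>v\<in>A. real (degree A E v) * resistance A E v a + real (degree A E v) * (1 + resistance B E b c)
          + (if v = a then resistance A E a a + (1 + resistance B E b c) else 0))"
    using assms by (intro sum.cong) (auto simp: degree_union resistance_across algebra_simps)
  also have "\<dots> = deg_res_sum A E a + (deg_sum A E + 1) * (1 + resistance B E b c)"
    using finite_parts a_in res_A
    by (simp add: sum.distrib deg_res_sum_def deg_sum_def sum_distrib_left[symmetric] sum_distrib_right[symmetric] resistance_self resistive_def algebra_simps)
  finally have 1: "(\<Sum>v\<in>A. real (degree (A \<union> B) E v) * resistance (A \<union> B) E v c)
     = deg_res_sum A E a + (deg_sum A E + 1) * (1 + resistance B E b c)" .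
  have "(\<Sum>v\<in>B. real (degree (A \<union> B) E v) * resistance (A \<union> B) E v c)
     = (\<Sum>v\<in>B. real (degree B E v) * resistance B E v c + (if v = b then resistance B E b c else 0))"
    using assms by (intro sum.cong) (auto simp: degree_union' resistance_within' algebra_simps)
  also have "\<dots> = deg_res_sum B E c + resistance B E b c"
    using finite_parts b_in by (simp add: sum.distrib deg_res_sum_def)
  finally show ?thesis
    using 1 finite_parts disjoint by (simp add: deg_res_sum_def sum.union_disjoint)
qed

text \<open>Resistances inside \<open>A\<close> are unchanged and only the degree of
  \<open>a\<close> grows. The extra unit contributes one resistance sum when \<open>a\<close> is the
  first entry of the ordered pair and one when it is the second.\<close>

lemma kf_within:
  "(\<Sum>u\<in>A. \<Sum>v\<in>A. (real (degree (A \<union> B) E u) + real (degree (A \<union> B) E v)) * resistance (A \<union> B) E u v)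
    = 2 * (kf_plus A E + res_sum A E a)"
proof -
  have "(\<Sum>u\<in>A. \<Sum>v\<in>A. (real (degree (A \<union> B) E u) + real (degree (A \<union> B) E v)) * resistance (A \<union> B) E u v)
    = (\<Sum>u\<in>A. \<Sum>v\<in>A. (real (degree A E u) + real (degree A E v)) * resistance A E u v
         + (if u = a then resistance A E v a else 0) + (if v = a then resistance A E u a else 0))"
    by (intro sum.cong refl)
       (auto simp: degree_union resistance_within algebra_simps resistance_commute[OF res_A])
  also have "\<dots> = 2 * kf_plus A E + (\<Sum>u\<in>A. \<Sum>v\<in>A. if u = a then resistance A E v a else 0)
       + (\<Sum>u\<in>A. \<Sum>v\<in>A. if v = a then resistance A E u a else 0)"
    using res_A by (simp add: sum.distrib kf_plus_double_sum resistive_def)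
  also have "(\<Sum>u\<in>A. \<Sum>v\<in>A. if u = a then resistance A E v a else 0) = res_sum A E a"
    by (subst sum.swap) (use finite_parts a_in in \<open>simp add: res_sum_def\<close>)
  also have "(\<Sum>u\<in>A. \<Sum>v\<in>A. if v = a then resistance A E u a else 0) = res_sum A E a"
    using finite_parts a_in by (simp add: res_sum_def)
  finally show ?thesis by simp
qed

lemma kf_across:
  "(\<Sum>u\<in>A. \<Sum>v\<in>B. (real (degree (A \<union> B) E u) + real (degree (A \<union> B) E v)) * resistance (A \<union> B) E u v)
    = res_sum A E a + res_sum B E b
      + real (card B) * (deg_res_sum A E a + deg_sum A E + 1)
      + real (card A) * (deg_res_sum B E b + deg_sum B E + 1)
      + deg_sum A E * res_sum B E b + deg_sum B E * res_sum A E a"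
proof -
  \<comment> \<open>Here \<open>d\<close> and \<open>r\<close> stand for the degree of
    \<open>u\<close> and its resistance to \<open>a\<close>. Evaluating the inner sum for generic
    values leaves an outer sum that again consists only of resistance and degree sums of
    \<open>A\<close>.\<close>
  have inner: "(\<Sum>v\<in>B. (d + real (degree (A \<union> B) E v)) * (r + 1 + resistance B E b v))
     = (d * (r + 1)) * real (card B) + d * res_sum B E b + (deg_sum B E + 1) * (r + 1) + deg_res_sum B E b" for d r
  proof -
    have "(\<Sum>v\<in>B. (d + real (degree (A \<union> B) E v)) * (r + 1 + resistance B E b v))
      = (\<Sum>v\<in>B. d * (r + 1) + d * resistance B E v b + real (degree B E v) * (r + 1)
            + real (degree B E v) * resistance B E v b + (if v = b then r + 1 + resistance B E b b else 0))"
      using b_in by (intro sum.cong refl)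
        (auto simp: degree_union' algebra_simps resistance_commute[OF res_B])
    also have "\<dots> = (d * (r + 1)) * real (card B) + d * res_sum B E b + (deg_sum B E + 1) * (r + 1) + deg_res_sum B E b"
      using finite_parts b_in res_B
      by (simp add: sum.distrib res_sum_def deg_sum_def deg_res_sum_def sum_distrib_left[symmetric]
          sum_distrib_right[symmetric] resistance_self resistive_def algebra_simps)
    finally show ?thesis .
  qed
  have "(\<Sum>u\<in>A. \<Sum>v\<in>B. (real (degree (A \<union> B) E u) + real (degree (A \<union> B) E v)) * resistance (A \<union> B) E u v)
     = (\<Sum>u\<in>A. (real (degree (A \<union> B) E u) * (resistance A E u a + 1)) * real (card B)
          + real (degree (A \<union> B) E u) * res_sum B E b
          + (deg_sum B E + 1) * (resistance A E u a + 1) + deg_res_sum B E b)"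
    by (intro sum.cong refl) (simp add: resistance_across inner)
  also have "\<dots> = (\<Sum>u\<in>A. (real (degree A E u) * resistance A E u a) * real (card B)
         + real (degree A E u) * (real (card B) + res_sum B E b)
         + (if u = a then (resistance A E a a + 1) * real (card B) + res_sum B E b else 0)
         + (deg_sum B E + 1) * (resistance A E u a) + (deg_sum B E + 1 + deg_res_sum B E b))"
    by (intro sum.cong refl) (auto simp: degree_union algebra_simps)
  also have "\<dots> = deg_res_sum A E a * real (card B) + deg_sum A E * (real (card B) + res_sum B E b)
         + (real (card B) + res_sum B E b)
         + (deg_sum B E + 1) * res_sum A E a + real (card A) * (deg_sum B E + 1 + deg_res_sum B E b)"
    using finite_parts a_in res_A
    by (simp add: sum.distrib res_sum_def deg_sum_def deg_res_sum_def sum_distrib_left[symmetric]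
          sum_distrib_right[symmetric] resistance_self resistive_def)
  finally show ?thesis by (simp add: algebra_simps)
qed

text \<open>The double sum over the union has four blocks: two internal ones, each twice an index
  plus a correction, and two equal mixed ones. Halving keeps one mixed block.\<close>

lemma kf_plus_union:
  "kf_plus (A \<union> B) E = kf_plus A E + kf_plus B E + 2 * res_sum A E a + 2 * res_sum B E b
      + real (card B) * (deg_res_sum A E a + deg_sum A E + 1)
      + real (card A) * (deg_res_sum B E b + deg_sum B E + 1)
      + deg_sum A E * res_sum B E b + deg_sum B E * res_sum A E a"
proof -
  let ?f = "\<lambda>u v. (real (degree (A \<union> B) E u) + real (degree (A \<union> B) E v)) * resistance (A \<union> B) E u v"
  have BA: "(\<Sum>u\<in>B. \<Sum>v\<in>A. ?f u v) = (\<Sum>u\<in>A. \<Sum>v\<in>B. ?f u v)"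
    by (subst sum.swap) (auto intro!: sum.cong simp: resistance_commute[OF resistive_union])
  have BB: "(\<Sum>u\<in>B. \<Sum>v\<in>B. ?f u v) = 2 * (kf_plus B E + res_sum B E b)"
    using bridge.kf_within[OF swapped] by (simp add: Un_commute)
  have "2 * kf_plus (A \<union> B) E = (\<Sum>u\<in>A \<union> B. \<Sum>v\<in>A \<union> B. ?f u v)"
    using kf_plus_double_sum[OF _ sym_union] finite_parts by simp
  also have "\<dots> = (\<Sum>u\<in>A. \<Sum>v\<in>A. ?f u v) + (\<Sum>u\<in>A. \<Sum>v\<in>B. ?f u v)
      + (\<Sum>u\<in>B. \<Sum>v\<in>A. ?f u v) + (\<Sum>u\<in>B. \<Sum>v\<in>B. ?f u v)"
    using finite_parts disjoint by (simp add: sum.union_disjoint sum.distrib)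
  finally show ?thesis
    unfolding BA BB kf_within kf_across by simp
qed

end

section \<open>Pentagonal chains\<close>

text \<open>The two arcs of lengths \<open>d\<close> and \<open>5 - d\<close> between two vertices of a pentagon are resistors in parallel.\<close>

definition cycle_res :: "nat \<Rightarrow> nat \<Rightarrow> real" where
  "cycle_res i j = \<bar>real i - real j\<bar> * (5 - \<bar>real i - real j\<bar>) / 5"

definition pentagon :: "nat \<Rightarrow> (nat \<times> nat) set" where
  "pentagon k = {k} \<times> {0..<5}"

section \<open>A single pentagon\<close>

lemma atLeastLessThan_5: "{0..<5::nat} = {0, 1, 2, 3, 4}"
  by auto

lemma less_5_cases: "i < 5 \<Longrightarrow> i = 0 \<or> i = 1 \<or> i = 2 \<or> i = 3 \<or> i = (4::nat)"
  by linarith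

lemma sum_pentagon: "(\<Sum>x\<in>pentagon k. f x) = (\<Sum>j\<in>{0..<5}. f (k, j))"
proof -
  have "pentagon k = Pair k ` {0..<5}" by (auto simp: pentagon_def)
  then show ?thesis by (simp add: sum.reindex inj_on_def)
qed

lemma pg_adj_same: "pg_adj cs (k, i) (k, j) \<longleftrightarrow> j = Suc i mod 5 \<or> i = Suc j mod 5"
  by (simp add: pg_adj_def pg_link_def)

lemma symp_pg_adj: "symp_on V (pg_adj cs)"
  by (rule symp_onI) (auto simp: pg_adj_def)

lemma finite_pentagon [simp]: "finite (pentagon k)"
  by (simp add: pentagon_def)

text \<open>Along the cycle \<open>d * (5 - d) / 5\<close> is a concave quadratic in the distance
  \<open>d\<close>, with constant negated second difference 2/5, except for the kink at
  \<open>u\<close>, where both neighbours have value 4/5.\<close>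

lemma laplacian_cycle_res:
  assumes "i < 5" "u < 5"
  shows "laplacian (pentagon k) (pg_adj cs) (\<lambda>x. cycle_res (snd x) u) (k, i) = 2 / 5 - 2 * of_bool (i = u)"
  using less_5_cases[OF assms(1)] less_5_cases[OF assms(2)]
  unfolding laplacian_indicator[OF finite_pentagon] sum_pentagon pg_adj_same atLeastLessThan_5
  by (elim disjE) (simp_all add: cycle_res_def)

text \<open>In the difference the constants 2/5 cancel, and halving turns the point masses of size 2
  into unit ones.\<close>

lemma unit_potential_pentagon:
  assumes "u < 5" "v < 5"
  shows "unit_potential (pentagon k) (pg_adj cs) (k, u) (k, v)
    (\<lambda>x. (cycle_res (snd x) v - cycle_res (snd x) u) / 2)"
  unfolding unit_potential_def
proof
  fix x assume "x \<in> pentagon k"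
  then obtain i where x: "x = (k, i)" and i: "i < 5" by (auto simp: pentagon_def)
  have "laplacian (pentagon k) (pg_adj cs) (\<lambda>x. (cycle_res (snd x) v - cycle_res (snd x) u) / 2) x
      = (laplacian (pentagon k) (pg_adj cs) (\<lambda>x. cycle_res (snd x) v) x
       - laplacian (pentagon k) (pg_adj cs) (\<lambda>x. cycle_res (snd x) u) x) / 2"
    unfolding laplacian_def sum_subtractf[symmetric] sum_divide_distrib
    by (rule sum.cong) (auto simp: field_simps)
  also have "\<dots> = of_bool (i = u) - of_bool (i = v)"
    by (simp add: x laplacian_cycle_res i assms)
  finally show "laplacian (pentagon k) (pg_adj cs) (\<lambda>x. (cycle_res (snd x) v - cycle_res (snd x) u) / 2) x
      = (if x = (k, u) then 1 else 0) - (if x = (k, v) then 1 else 0)"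
    by (simp add: x)
qed

lemma resistive_pentagon: "resistive (pentagon k) (pg_adj cs)"
  unfolding resistive_def using unit_potential_pentagon symp_pg_adj
  by (fastforce simp: pentagon_def)

lemma resistance_pentagon:
  assumes "u < 5" "v < 5"
  shows "resistance (pentagon k) (pg_adj cs) (k, u) (k, v) = cycle_res u v"
  using resistance_eqI[OF _ symp_pg_adj _ _ unit_potential_pentagon[OF assms, of k cs]] assms
  by (simp add: pentagon_def cycle_res_def abs_minus_commute)

lemma degree_pentagon:
  assumes "i < 5"
  shows "degree (pentagon k) (pg_adj cs) (k, i) = 2"
proof -
  \<comment> \<open>The predecessor of \<open>i\<close> on the cycle is written
    \<open>(i + 4) mod 5\<close> to avoid truncated subtraction.\<close>
  have "{y \<in> pentagon k. pg_adj cs (k, i) y} = Pair k ` {Suc i mod 5, (i + 4) mod 5}"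
    using less_5_cases[OF assms] by (elim disjE) (auto simp: pentagon_def pg_adj_same atLeastLessThan_5)
  moreover have "Suc i mod 5 \<noteq> (i + 4) mod 5"
    using less_5_cases[OF assms] by (elim disjE) auto
  ultimately show ?thesis
    by (simp add: degree_def card_image inj_on_def)
qed

lemma deg_sum_pentagon: "deg_sum (pentagon k) (pg_adj cs) = 10"
  by (simp add: deg_sum_def sum_pentagon degree_pentagon)

text \<open>From any vertex, two others are at resistance 4/5 and two at 6/5.\<close>

lemma res_sum_pentagon:
  assumes "c < 5"
  shows "res_sum (pentagon k) (pg_adj cs) (k, c) = 4"
proof -
  have "res_sum (pentagon k) (pg_adj cs) (k, c) = (\<Sum>j\<in>{0..<5}. cycle_res j c)"
    unfolding res_sum_def sum_pentagon using assms by (simp add: resistance_pentagon)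
  also have "\<dots> = 4"
    unfolding atLeastLessThan_5 using less_5_cases[OF assms] by (elim disjE) (simp_all add: cycle_res_def)
  finally show ?thesis .
qed

lemma deg_res_sum_pentagon:
  assumes "c < 5"
  shows "deg_res_sum (pentagon k) (pg_adj cs) (k, c) = 8"
proof -
  have "deg_res_sum (pentagon k) (pg_adj cs) (k, c) = 2 * res_sum (pentagon k) (pg_adj cs) (k, c)"
    unfolding deg_res_sum_def res_sum_def sum_pentagon by (simp add: degree_pentagon sum_distrib_left)
  then show ?thesis using assms by (simp add: res_sum_pentagon)
qed

lemma kf_plus_pentagon: "kf_plus (pentagon k) (pg_adj cs) = 40"
proof -
  have "2 * kf_plus (pentagon k) (pg_adj cs)
      = (\<Sum>v\<in>pentagon k. \<Sum>u\<in>pentagon k. 4 * resistance (pentagon k) (pg_adj cs) u v)"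
    unfolding kf_plus_double_sum[OF finite_pentagon symp_pg_adj]
    by (subst sum.swap) (simp add: sum_pentagon degree_pentagon)
  also have "\<dots> = (\<Sum>v\<in>pentagon k. 4 * res_sum (pentagon k) (pg_adj cs) v)"
    by (simp add: res_sum_def sum_distrib_left)
  also have "\<dots> = 80"
    by (simp add: sum_pentagon res_sum_pentagon)
  finally show ?thesis by simp
qed

section \<open>The recursion along the chain\<close>

lemma pg_vertices_1: "pg_vertices (Suc 0) = pentagon 0"
  by (auto simp: pg_vertices_def pentagon_def)

lemma pg_vertices_Suc: "pg_vertices (Suc n) = pg_vertices n \<union> pentagon n"
  by (auto simp: pg_vertices_def pentagon_def)

lemma card_pg_vertices: "card (pg_vertices n) = 5 * n"
  by (simp add: pg_vertices_def)

text \<open>Pentagons are numbered from 0, so \<open>pentagon n\<close> is the last one of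
  \<open>pg_vertices (Suc n)\<close>. Being \<open>resistive\<close> is assumed here because the
  induction proving it uses this lemma; \<open>bridge_pg'\<close> then discharges it.\<close>

lemma bridge_pg:
  assumes "cs ! n < 5" "resistive (pg_vertices (Suc n)) (pg_adj cs)"
  shows "bridge (pg_vertices (Suc n)) (pentagon (Suc n)) (pg_adj cs) (n, cs ! n) (Suc n, 0)"
  using assms resistive_pentagon
  by unfold_locales (auto simp: pg_vertices_def pentagon_def pg_adj_def pg_link_def)

lemma resistive_pg:
  assumes "\<And>k. k < n \<Longrightarrow> cs ! k < 5"
  shows "resistive (pg_vertices (Suc n)) (pg_adj cs)"
  using assms
proof (induction n)
  case 0
  then show ?case by (simp add: pg_vertices_1 resistive_pentagon)
next
  case (Suc n)
  then have "bridge (pg_vertices (Suc n)) (pentagon (Suc n)) (pg_adj cs) (n, cs ! n) (Suc n, 0)"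
    by (intro bridge_pg) auto
  from bridge.resistive_union[OF this] show ?case
    by (simp only: pg_vertices_Suc[of "Suc n"])
qed

lemma bridge_pg':
  assumes "\<And>k. k \<le> n \<Longrightarrow> cs ! k < 5"
  shows "bridge (pg_vertices (Suc n)) (pentagon (Suc n)) (pg_adj cs) (n, cs ! n) (Suc n, 0)"
  using assms by (intro bridge_pg resistive_pg) auto

lemma deg_sum_pg:
  assumes "\<And>k. k < n \<Longrightarrow> cs ! k < 5"
  shows "deg_sum (pg_vertices (Suc n)) (pg_adj cs) = 12 * real n + 10"
  using assms
proof (induction n)
  case 0
  then show ?case by (simp add: pg_vertices_1 deg_sum_pentagon)
next
  case (Suc n)
  then have "bridge (pg_vertices (Suc n)) (pentagon (Suc n)) (pg_adj cs) (n, cs ! n) (Suc n, 0)"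
    by (intro bridge_pg') auto
  from bridge.deg_sum_union[OF this] Suc show ?case
    by (simp add: pg_vertices_Suc[of "Suc n"] deg_sum_pentagon)
qed

text \<open>Only this combination enters the recursion for \<^const>\<open>kf_plus\<close>: a new pentagon brings total degree
  \<open>10\<close>, five vertices, and two more units of degree at the ends of the bridge.\<close>

lemma res_sum_combination_pg:
  assumes "\<And>k. k \<le> n \<Longrightarrow> cs ! k < 5"
  shows "12 * res_sum (pg_vertices (Suc n)) (pg_adj cs) (n, cs ! n)
       + 5 * deg_res_sum (pg_vertices (Suc n)) (pg_adj cs) (n, cs ! n)
     = 88 + 143 * real n + 60 * real n ^ 2 + (\<Sum>i\<le>n. 120 * real i * cycle_res 0 (cs ! i))"
  using assms
proof (induction n)
  case 0
  then show ?case by (simp add: pg_vertices_1 res_sum_pentagon deg_res_sum_pentagon)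
next
  case (Suc n)
  then interpret bridge "pg_vertices (Suc n)" "pentagon (Suc n)" "pg_adj cs" "(n, cs ! n)" "(Suc n, 0)"
    by (intro bridge_pg') auto
  have c: "cs ! Suc n < 5" using Suc.prems by simp
  then have "(Suc n, cs ! Suc n) \<in> pentagon (Suc n)" by (simp add: pentagon_def)
  note unions = res_sum_union[OF this] deg_res_sum_union[OF this]
  have d: "deg_sum (pg_vertices (Suc n)) (pg_adj cs) = 12 * real n + 10"
    using Suc.prems by (intro deg_sum_pg) auto
  have IH: "12 * res_sum (pg_vertices (Suc n)) (pg_adj cs) (n, cs ! n)
       + 5 * deg_res_sum (pg_vertices (Suc n)) (pg_adj cs) (n, cs ! n)
     = 88 + 143 * real n + 60 * real n ^ 2 + (\<Sum>i\<le>n. 120 * real i * cycle_res 0 (cs ! i))"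
    using Suc by simp
  show ?case
    \<comment> \<open>The resistance to the new attachment vertex gets the coefficient
      \<open>12 * 5 * (n + 1) + 5 * (12 * n + 11) + 5\<close>, which is
      \<open>120 * (n + 1)\<close>.\<close>
    unfolding pg_vertices_Suc[of "Suc n"] unions card_pg_vertices d
    using IH c
    by (simp add: resistance_pentagon res_sum_pentagon deg_res_sum_pentagon field_simps power2_eq_square)
qed

text \<open>In \<open>kf_plus_union\<close> with a pentagon as \<open>B\<close>, the resistance sum
  of the old chain has coefficient 2 + 10 and its degree-weighted sum coefficient 5: exactly the
  combination computed above. Here \<open>n\<close> counts bridges, and accumulating the increments
  gives the term of index \<open>i\<close> the factor \<open>n - i\<close>.\<close>

theorem kf_pg_eq:
  assumes "\<And>k. k < n \<Longrightarrow> cs ! k < 5"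
  shows "kf_pg (Suc n) cs = 40 + 163 * real n + 143 * real n ^ 2 + 20 * real n ^ 3
    + (\<Sum>i<n. 120 * real i * (real n - real i) * cycle_res 0 (cs ! i))"
  unfolding kf_pg_def using assms
proof (induction n)
  case 0
  then show ?case by (simp add: pg_vertices_1 kf_plus_pentagon)
next
  case (Suc n)
  then interpret bridge "pg_vertices (Suc n)" "pentagon (Suc n)" "pg_adj cs" "(n, cs ! n)" "(Suc n, 0)"
    by (intro bridge_pg') auto
  have d: "deg_sum (pg_vertices (Suc n)) (pg_adj cs) = 12 * real n + 10"
    using Suc.prems by (intro deg_sum_pg) auto
  have S: "12 * res_sum (pg_vertices (Suc n)) (pg_adj cs) (n, cs ! n)
       + 5 * deg_res_sum (pg_vertices (Suc n)) (pg_adj cs) (n, cs ! n)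
     = 88 + 143 * real n + 60 * real n ^ 2 + (\<Sum>i\<le>n. 120 * real i * cycle_res 0 (cs ! i))"
    using Suc.prems by (intro res_sum_combination_pg) auto
  have IH: "kf_plus (pg_vertices (Suc n)) (pg_adj cs) = 40 + 163 * real n + 143 * real n ^ 2 + 20 * real n ^ 3
    + (\<Sum>i<n. 120 * real i * (real n - real i) * cycle_res 0 (cs ! i))"
    using Suc by simp
  \<comment> \<open>Passing from \<open>n\<close> to \<open>n + 1\<close> adds one copy of
    \<open>120 * i * cycle_res 0 (cs ! i)\<close> for each \<open>i\<close>; in the remaining part
    the summand \<open>i = n\<close> is zero.\<close>
  have "(\<Sum>i<Suc n. 120 * real i * (real (Suc n) - real i) * cycle_res 0 (cs ! i))
     = (\<Sum>i\<le>n. 120 * real i * (real n - real i) * cycle_res 0 (cs ! i) + 120 * real i * cycle_res 0 (cs ! i))"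
    by (simp add: lessThan_Suc_atMost algebra_simps)
  also have "\<dots> = (\<Sum>i<n. 120 * real i * (real n - real i) * cycle_res 0 (cs ! i))
      + (\<Sum>i\<le>n. 120 * real i * cycle_res 0 (cs ! i))"
    by (simp add: sum.distrib lessThan_Suc_atMost[symmetric])
  finally have "(\<Sum>i<Suc n. 120 * real i * (real (Suc n) - real i) * cycle_res 0 (cs ! i)) = \<dots>" .
  note * = this
  have card: "card (pentagon (Suc n)) = 5" by (simp add: pentagon_def)
  show ?case
    unfolding pg_vertices_Suc[of "Suc n"] kf_plus_union * IH card_pg_vertices d card
    using S
    by (simp add: deg_sum_pentagon res_sum_pentagon deg_res_sum_pentagon kf_plus_pentagon
        field_simps power2_eq_square power3_eq_cube)
qed

section \<open>A central limit theorem for independent bounded choices\<close>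

lemma finite_rand_choices:
  assumes "\<forall>k\<ge>2. finite (set_pmf (q k))"
  shows "finite (set_pmf (rand_choices q m))"
  by (induction m) (auto simp: assms)

lemma length_rand_choices: "xs \<in> set_pmf (rand_choices q m) \<Longrightarrow> length xs = m"
  by (induction m arbitrary: xs) auto

text \<open>The random list starts with \<open>u_2\<close>, whence the offset 2 between position and
  law.\<close>

lemma nth_rand_choices:
  "xs \<in> set_pmf (rand_choices q m) \<Longrightarrow> i < m \<Longrightarrow> xs ! i \<in> set_pmf (q (i + 2))"
proof (induction m arbitrary: xs)
  case (Suc m)
  then show ?case
    by (auto simp: nth_append less_Suc_eq dest: length_rand_choices)
qed simp

lemma expectation_cong_pmf:
  fixes f g :: "'a \<Rightarrow> 'b::{banach, second_countable_topology}"
  assumes "\<And>x. x \<in> set_pmf p \<Longrightarrow> f x = g x"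
  shows "measure_pmf.expectation p f = measure_pmf.expectation p g"
  using assms by (intro integral_cong_AE) (auto simp: AE_measure_pmf_iff)

text \<open>Fubini for the last choice; finite supports reduce it to finite sums.\<close>

lemma expectation_rand_choices_Suc:
  fixes h :: "nat list \<Rightarrow> 'b::{banach, second_countable_topology}"
  assumes fin: "\<forall>k\<ge>2. finite (set_pmf (q k))"
  shows "measure_pmf.expectation (rand_choices q (Suc m)) h =
    measure_pmf.expectation (rand_choices q m)
      (\<lambda>xs. measure_pmf.expectation (q (m + 2)) (\<lambda>x. h (xs @ [x])))"
proof -
  let ?R = "rand_choices q m"
  have "measure_pmf.expectation (rand_choices q (Suc m)) h = (\<Sum>xs\<in>set_pmf ?R.
      pmf ?R xs *\<^sub>R measure_pmf.expectation (map_pmf (\<lambda>x. xs @ [x]) (q (m + 2))) h)"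
    unfolding rand_choices.simps using fin
    by (intro pmf_expectation_bind finite_rand_choices) auto
  also have "\<dots> = measure_pmf.expectation ?R
      (\<lambda>xs. measure_pmf.expectation (q (m + 2)) (\<lambda>x. h (xs @ [x])))"
    using fin by (subst integral_measure_pmf[where A = "set_pmf ?R"]) (auto simp: finite_rand_choices)
  finally show ?thesis .
qed

text \<open>Independence in the form used for characteristic functions, hence with complex
  values.\<close>

lemma expectation_prod_rand_choices:
  fixes f :: "nat \<Rightarrow> nat \<Rightarrow> complex"
  assumes fin: "\<forall>k\<ge>2. finite (set_pmf (q k))"
  shows "measure_pmf.expectation (rand_choices q m) (\<lambda>xs. \<Prod>i<m. f i (xs ! i)) =
    (\<Prod>i<m. measure_pmf.expectation (q (i + 2)) (f i))"
proof (induction m)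
  case (Suc m)
  have "measure_pmf.expectation (rand_choices q (Suc m)) (\<lambda>xs. \<Prod>i<Suc m. f i (xs ! i)) =
    measure_pmf.expectation (rand_choices q m)
      (\<lambda>xs. (\<Prod>i<m. f i (xs ! i)) * measure_pmf.expectation (q (m + 2)) (f m))"
    unfolding expectation_rand_choices_Suc[OF fin]
    by (intro expectation_cong_pmf) (simp add: length_rand_choices nth_append)
  then show ?case by (simp add: Suc.IH)
qed simp

text \<open>When the last square is expanded, the cross term is linear in a centred variable
  independent of the earlier ones, so second moments add up.\<close>

lemma moments_rand_choices:
  fixes h :: "nat \<Rightarrow> nat \<Rightarrow> real"
  assumes fin: "\<forall>k\<ge>2. finite (set_pmf (q k))"
    and mean: "\<And>i. measure_pmf.expectation (q (i + 2)) (h i) = 0"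
  shows "measure_pmf.expectation (rand_choices q m) (\<lambda>xs. \<Sum>i<m. h i (xs ! i)) = 0"
    and "measure_pmf.expectation (rand_choices q m) (\<lambda>xs. (\<Sum>i<m. h i (xs ! i))\<^sup>2) =
      (\<Sum>i<m. measure_pmf.expectation (q (i + 2)) (\<lambda>x. (h i x)\<^sup>2))"
proof (induction m)
  case (Suc m)
  note [simp] = integrable_measure_pmf_finite[OF finite_rand_choices[OF fin]]
    integrable_measure_pmf_finite[OF fin[rule_format]]
  let ?S = "\<lambda>xs. \<Sum>i<m. h i (xs ! i)"
  {
    case 1
    have "measure_pmf.expectation (rand_choices q (Suc m)) (\<lambda>xs. \<Sum>i<Suc m. h i (xs ! i)) =
      measure_pmf.expectation (rand_choices q m) ?S"
      unfolding expectation_rand_choices_Suc[OF fin]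
      by (intro expectation_cong_pmf) (simp add: length_rand_choices nth_append mean[simplified])
    then show ?case by (simp add: Suc.IH)
  next
    case 2
    have "measure_pmf.expectation (rand_choices q (Suc m)) (\<lambda>xs. (\<Sum>i<Suc m. h i (xs ! i))\<^sup>2) =
      measure_pmf.expectation (rand_choices q m)
        (\<lambda>xs. (?S xs)\<^sup>2 + measure_pmf.expectation (q (m + 2)) (\<lambda>x. (h m x)\<^sup>2))"
      unfolding expectation_rand_choices_Suc[OF fin]
    proof (intro expectation_cong_pmf)
      fix xs assume "xs \<in> set_pmf (rand_choices q m)"
      then have "measure_pmf.expectation (q (m + 2)) (\<lambda>x. (\<Sum>i<Suc m. h i ((xs @ [x]) ! i))\<^sup>2) =
        measure_pmf.expectation (q (m + 2)) (\<lambda>x. ((?S xs)\<^sup>2 + 2 * ?S xs * h m x) + (h m x)\<^sup>2)"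
        by (intro expectation_cong_pmf) (simp add: length_rand_choices nth_append power2_sum)
      also have "\<dots> = (?S xs)\<^sup>2 + measure_pmf.expectation (q (m + 2)) (\<lambda>x. (h m x)\<^sup>2)"
        using mean[of m] by simp
      finally show "measure_pmf.expectation (q (m + 2)) (\<lambda>x. (\<Sum>i<Suc m. h i ((xs @ [x]) ! i))\<^sup>2) = \<dots>" .
    qed
    then show ?case by (simp add: Suc.IH)
  }
qed simp_all

section \<open>Characteristic functions of small centred variables\<close>

lemma exp_minus_approx:
  assumes "0 \<le> (y::real)"
  shows "\<bar>exp (- y) - (1 - y)\<bar> \<le> y\<^sup>2"
proof -
  have "exp (- y) \<le> 1 / (1 + y)"
    using exp_ge_add_one_self[of y] assms by (simp add: exp_minus field_simps)
  also have "\<dots> \<le> 1 - y + y\<^sup>2"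
  proof -
    \<comment> \<open>The product equals \<open>1 + y^3\<close>.\<close>
    have "1 \<le> (1 - y + y\<^sup>2) * (1 + y)"
      using assms by (simp add: algebra_simps power2_eq_square)
    then show ?thesis using assms by (simp add: divide_le_eq)
  qed
  finally show ?thesis
    using exp_ge_add_one_self[of "- y"] by simp
qed

text \<open>Both quantities are compared with \<open>1 - t^2 * s / 2\<close>. The factor
  \<open>s\<close> is kept in the error so that the errors of many summands add up to a multiple of
  the total variance.\<close>

lemma char_centered_approx:
  fixes X :: "'a \<Rightarrow> real"
  assumes fin: "finite (set_pmf p)" and mean: "measure_pmf.expectation p X = 0"
    and bound: "\<And>x. x \<in> set_pmf p \<Longrightarrow> \<bar>X x\<bar> \<le> e"
  defines "s \<equiv> measure_pmf.expectation p (\<lambda>x. (X x)\<^sup>2)"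
  shows "cmod (char (distr p borel X) t - exp (- (t\<^sup>2 * s / 2))) \<le> (\<bar>t\<bar> ^ 3 * e + t ^ 4 * e\<^sup>2) * s"
proof -
  note [simp] = integrable_measure_pmf_finite[OF fin]
  obtain x where "x \<in> set_pmf p" using set_pmf_not_empty[of p] by blast
  then have e: "0 \<le> e" using bound[of x] by linarith
  have s0: "0 \<le> s" unfolding s_def by simp
  have se: "s \<le> e\<^sup>2"
  proof -
    have "s \<le> measure_pmf.expectation p (\<lambda>_. e\<^sup>2)"
      unfolding s_def
      by (intro integral_mono_AE) (auto simp: AE_measure_pmf_iff abs_le_square_iff[symmetric] e bound)
    then show ?thesis by simp
  qed
  have "measure_pmf.expectation p (\<lambda>x. min (6 * (X x)\<^sup>2) (\<bar>t\<bar> * \<bar>X x\<bar> ^ 3)) \<le>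
      measure_pmf.expectation p (\<lambda>x. \<bar>t\<bar> * e * (X x)\<^sup>2)"
  proof (intro integral_mono_AE, simp, simp, unfold AE_measure_pmf_iff, intro ballI)
    fix x assume "x \<in> set_pmf p"
    then have "\<bar>X x\<bar> * (X x)\<^sup>2 \<le> e * (X x)\<^sup>2" by (intro mult_right_mono bound) auto
    moreover have "\<bar>X x\<bar> ^ 3 = \<bar>X x\<bar> * (X x)\<^sup>2" by (simp add: power3_eq_cube power2_eq_square)
    ultimately have "\<bar>t\<bar> * \<bar>X x\<bar> ^ 3 \<le> \<bar>t\<bar> * (e * (X x)\<^sup>2)" by (intro mult_left_mono) auto
    then show "min (6 * (X x)\<^sup>2) (\<bar>t\<bar> * \<bar>X x\<bar> ^ 3) \<le> \<bar>t\<bar> * e * (X x)\<^sup>2" by (simp add: mult.assoc)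
  qed
  also have "\<dots> = \<bar>t\<bar> * e * s" by (simp add: s_def)
  finally have min: "measure_pmf.expectation p (\<lambda>x. min (6 * (X x)\<^sup>2) (\<bar>t\<bar> * \<bar>X x\<bar> ^ 3)) \<le> \<bar>t\<bar> * e * s" .
  have "cmod (char (distr p borel X) t - (1 - t\<^sup>2 * s / 2)) \<le>
      t\<^sup>2 / 6 * measure_pmf.expectation p (\<lambda>x. min (6 * (X x)\<^sup>2) (\<bar>t\<bar> * \<bar>X x\<bar> ^ 3))"
    using mean by (intro prob_space.char_approx3'[OF prob_space_measure_pmf]) (auto simp: s_def)
  also have "\<dots> \<le> t\<^sup>2 / 6 * (\<bar>t\<bar> * e * s)"
    by (intro mult_left_mono min) auto
  also have "\<dots> = \<bar>t\<bar> ^ 3 * e * s / 6"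
    by (simp add: power3_eq_cube power2_eq_square)
  also have "\<dots> \<le> \<bar>t\<bar> ^ 3 * e * s"
    using e s0 by simp
  finally have 1: "cmod (char (distr p borel X) t - (1 - t\<^sup>2 * s / 2)) \<le> \<bar>t\<bar> ^ 3 * e * s" .
  have "cmod (complex_of_real (1 - t\<^sup>2 * s / 2) - complex_of_real (exp (- (t\<^sup>2 * s / 2))))
      = \<bar>exp (- (t\<^sup>2 * s / 2)) - (1 - t\<^sup>2 * s / 2)\<bar>"
    by (simp only: of_real_diff[symmetric] norm_of_real abs_minus_commute)
  also have "\<dots> \<le> (t\<^sup>2 * s / 2)\<^sup>2"
    using s0 by (intro exp_minus_approx) auto
  also have "\<dots> = (t ^ 4 * s / 4) * s"
    by (simp add: field_simps power2_eq_square power4_eq_xxxx)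
  \<comment> \<open>One of the two factors \<open>s\<close> is traded for \<open>e^2\<close>, the
    other is kept.\<close>
  also have "\<dots> \<le> (t ^ 4 * e\<^sup>2) * s"
  proof (intro mult_right_mono s0)
    have "t ^ 4 * s \<le> t ^ 4 * e\<^sup>2" "0 \<le> t ^ 4 * s" using se s0 by (auto intro!: mult_left_mono)
    then show "t ^ 4 * s / 4 \<le> t ^ 4 * e\<^sup>2" by linarith
  qed
  finally have 2: "cmod (complex_of_real (1 - t\<^sup>2 * s / 2) - complex_of_real (exp (- (t\<^sup>2 * s / 2))))
     \<le> (t ^ 4 * e\<^sup>2) * s" .
  have "char (distr p borel X) t - exp (- (t\<^sup>2 * s / 2)) =
      (char (distr p borel X) t - (1 - t\<^sup>2 * s / 2))
      + (complex_of_real (1 - t\<^sup>2 * s / 2) - complex_of_real (exp (- (t\<^sup>2 * s / 2))))"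
    by simp
  then have "cmod (char (distr p borel X) t - exp (- (t\<^sup>2 * s / 2)))
      \<le> \<bar>t\<bar> ^ 3 * e * s + (t ^ 4 * e\<^sup>2) * s"
    using norm_triangle_mono[OF 1 2] by simp
  then show ?thesis by (simp add: algebra_simps)
qed

text \<open>A central limit theorem for a triangular array: row \<open>m\<close> has total variance
  1 and entries bounded by \<open>e m\<close>. By Levy continuity it suffices to compare
  characteristic functions pointwise.\<close>

theorem clt_rand_choices:
  fixes Y :: "nat \<Rightarrow> nat \<Rightarrow> nat \<Rightarrow> real"
  assumes fin: "\<forall>k\<ge>2. finite (set_pmf (q k))"
    and mean: "\<And>m i. measure_pmf.expectation (q (i + 2)) (Y m i) = 0"
    and var: "\<And>m. m \<ge> 1 \<Longrightarrow> (\<Sum>i<m. measure_pmf.expectation (q (i + 2)) (\<lambda>x. (Y m i x)\<^sup>2)) = 1"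
    and bound: "\<And>m i x. i < m \<Longrightarrow> x \<in> set_pmf (q (i + 2)) \<Longrightarrow> \<bar>Y m i x\<bar> \<le> e m"
    and e: "e \<longlonglongrightarrow> 0"
  shows "weak_conv_m (\<lambda>m. distr (rand_choices q m) borel (\<lambda>xs. \<Sum>i<m. Y m i (xs ! i))) std_normal_distribution"
proof (rule levy_continuity)
  fix t :: real
  let ?phi = "\<lambda>m. char (distr (rand_choices q m) borel (\<lambda>xs. \<Sum>i<m. Y m i (xs ! i))) t"
  let ?s = "\<lambda>m i. measure_pmf.expectation (q (i + 2)) (\<lambda>x. (Y m i x)\<^sup>2)"
  have prod: "?phi m = (\<Prod>i<m. char (distr (q (i + 2)) borel (Y m i)) t)" for m
  proof -
    have "?phi m = measure_pmf.expectation (rand_choices q m) (\<lambda>xs. \<Prod>i<m. iexp (t * Y m i (xs ! i)))"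
      by (simp add: char_def integral_distr sum_distrib_left exp_sum)
    also have "\<dots> = (\<Prod>i<m. char (distr (q (i + 2)) borel (Y m i)) t)"
      by (subst expectation_prod_rand_choices[OF fin]) (simp_all add: char_def integral_distr)
    finally show ?thesis .
  qed
  have "cmod (?phi m - exp (- (t\<^sup>2) / 2)) \<le> \<bar>t\<bar> ^ 3 * e m + t ^ 4 * (e m)\<^sup>2" if "m \<ge> 1" for m
  proof -
    \<comment> \<open>Since the variances of a row sum to 1, the Gaussian value factors into one
      Gaussian per summand.\<close>
    have "complex_of_real (exp (- (t\<^sup>2) / 2)) = complex_of_real (\<Prod>i<m. exp (- (t\<^sup>2 * ?s m i / 2)))"
    proof -
      have "(\<Prod>i<m. exp (- (t\<^sup>2 * ?s m i / 2))) = exp (\<Sum>i<m. - (t\<^sup>2 / 2) * ?s m i)"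
        by (simp add: exp_sum)
      also have "(\<Sum>i<m. - (t\<^sup>2 / 2) * ?s m i) = - (t\<^sup>2) / 2"
        unfolding sum_distrib_left[symmetric] var[OF that] by simp
      finally show ?thesis by simp
    qed
    then have "cmod (?phi m - exp (- (t\<^sup>2) / 2)) =
        cmod ((\<Prod>i<m. char (distr (q (i + 2)) borel (Y m i)) t)
            - (\<Prod>i<m. complex_of_real (exp (- (t\<^sup>2 * ?s m i / 2)))))"
      unfolding prod by simp
    \<comment> \<open>All factors have modulus at most 1, so the difference of the products is at
      most the sum of the differences.\<close>
    also have "\<dots> \<le> (\<Sum>i<m. cmod (char (distr (q (i + 2)) borel (Y m i)) t
        - complex_of_real (exp (- (t\<^sup>2 * ?s m i / 2)))))"
      by (intro norm_prod_diff real_distribution.cmod_char_le_1 prob_space.real_distribution_distr[OF prob_space_measure_pmf])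
         (auto intro!: mult_nonneg_nonneg)
    also have "\<dots> \<le> (\<Sum>i<m. (\<bar>t\<bar> ^ 3 * e m + t ^ 4 * (e m)\<^sup>2) * ?s m i)"
      using fin mean bound by (intro sum_mono char_centered_approx) auto
    also have "\<dots> = \<bar>t\<bar> ^ 3 * e m + t ^ 4 * (e m)\<^sup>2"
      unfolding sum_distrib_left[symmetric] var[OF that] by simp
    finally show ?thesis .
  qed
  then have ev: "\<forall>\<^sub>F m in sequentially. cmod (?phi m - exp (- (t\<^sup>2) / 2)) \<le> \<bar>t\<bar> ^ 3 * e m + t ^ 4 * (e m)\<^sup>2"
    by (auto simp: eventually_sequentially)
  have "(\<lambda>m. \<bar>t\<bar> ^ 3 * e m + t ^ 4 * (e m)\<^sup>2) \<longlonglongrightarrow> \<bar>t\<bar> ^ 3 * 0 + t ^ 4 * 0\<^sup>2"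
    by (intro tendsto_intros e)
  then have lim: "(\<lambda>m. \<bar>t\<bar> ^ 3 * e m + t ^ 4 * (e m)\<^sup>2) \<longlonglongrightarrow> 0"
    by simp
  have "(\<lambda>m. ?phi m - exp (- (t\<^sup>2) / 2)) \<longlonglongrightarrow> 0"
    by (rule Lim_null_comparison[OF ev lim])
  then show "?phi \<longlonglongrightarrow> char std_normal_distribution t"
    unfolding char_std_normal_distribution by (rule LIM_zero_cancel)
qed (auto intro!: real_dist_normal_dist prob_space.real_distribution_distr[OF prob_space_measure_pmf])

text \<open>Polya's theorem: compare both distribution functions on a grid of quantiles of the limit.\<close>

theorem uniform_cdf_convergence:
  fixes M :: "nat \<Rightarrow> real measure"
  assumes M: "\<And>n. real_distribution (M n)" and N: "real_distribution N"
    and conv: "weak_conv_m M N" and cont: "\<And>x. isCont (cdf N) x"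
  shows "(\<lambda>n. SUP a. \<bar>cdf (M n) a - cdf N a\<bar>) \<longlonglongrightarrow> 0"
proof (rule LIMSEQ_I)
  fix r :: real assume r: "0 < r"
  interpret M: real_distribution "M n" for n by (rule M)
  interpret N: real_distribution N by (rule N)
  have ptw: "(\<lambda>n. cdf (M n) x) \<longlonglongrightarrow> cdf N x" for x
    using conv cont unfolding weak_conv_m_def weak_conv_def by blast
  obtain K :: nat where K: "4 / r < real K" using reals_Archimedean2 by blast
  have K0: "0 < real K" using K r by (smt (verit) divide_pos_pos)
  \<comment> \<open>Quantiles of the limit at the interior levels \<open>j / K\<close> exist by the
    intermediate value theorem.\<close>
  have "\<exists>x. cdf N x = real j / real K" if "j \<in> {1..<K}" for j
  proof -
    have j: "0 < real j / real K" "real j / real K < 1" using that by auto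
    obtain x where x: "cdf N x < real j / real K"
      using eventually_happens'[OF trivial_limit_at_bot_linorder order_tendstoD(2)[OF N.cdf_lim_at_bot j(1)]]
      by blast
    obtain y where y: "real j / real K < cdf N y"
      using eventually_happens'[OF trivial_limit_at_top_linorder order_tendstoD(1)[OF N.cdf_lim_at_top_prob j(2)]]
      by blast
    have "x \<le> y" using x y N.cdf_nondecreasing[of y x] by (cases "x \<le> y") auto
    then show ?thesis
      using IVT'[of "cdf N" x "real j / real K" y] x y cont
      by (auto intro: continuous_at_imp_continuous_on)
  qed
  then obtain g where g: "\<And>j. j \<in> {1..<K} \<Longrightarrow> cdf N (g j) = real j / real K" by metis
  have "\<forall>\<^sub>F n in sequentially. \<forall>j\<in>{1..<K}. \<bar>cdf (M n) (g j) - cdf N (g j)\<bar> < 1 / K"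
  proof (rule eventually_ball_finite)
    show "\<forall>j\<in>{1..<K}. \<forall>\<^sub>F n in sequentially. \<bar>cdf (M n) (g j) - cdf N (g j)\<bar> < 1 / real K"
      using tendstoD[OF ptw, of "1 / real K"] K0 by (auto simp: dist_real_def)
  qed simp
  then obtain n0 where n0: "\<And>n j. n \<ge> n0 \<Longrightarrow> j \<in> {1..<K} \<Longrightarrow> \<bar>cdf (M n) (g j) - cdf N (g j)\<bar> < 1 / K"
    unfolding eventually_sequentially by blast
  define d where "d = 1 / real K"
  have d: "0 < d" "real K * d = 1" using K0 by (auto simp: d_def)
  have close: "\<bar>cdf (M n) a - cdf N a\<bar> \<le> 3 * d" if n: "n \<ge> n0" for n a
  proof -
    \<comment> \<open>The level of \<open>a\<close> lies in the cell from \<open>j * d\<close> to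
      \<open>(j + 1) * d\<close>. The upper bound uses the quantile \<open>j + 1\<close>, or the
      trivial bound 1 when there is none.\<close>
    define j where "j = nat \<lfloor>real K * cdf N a\<rfloor>"
    have "0 \<le> real K * cdf N a" using K0 N.cdf_nonneg by simp
    then have jr: "real j \<le> real K * cdf N a" "real K * cdf N a < real j + 1"
      unfolding j_def by linarith+
    then have j: "real j * d \<le> cdf N a" "cdf N a < real j * d + d"
      using K0 by (simp_all add: d_def field_simps)
    have grid: "\<bar>cdf (M n) (g i) - real i * d\<bar> < d" "cdf N (g i) = real i * d" if "i \<in> {1..<K}" for i
      using n0[OF n that] g[OF that] by (simp_all add: d_def)
    have "cdf (M n) a \<le> cdf N a + 3 * d"
    proof (cases "j + 1 < K")
      case True
      then have i: "j + 1 \<in> {1..<K}" by simp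
      have e: "real (j + 1) * d = real j * d + d" by (simp add: algebra_simps)
      have "a \<le> g (j + 1)"
        using j grid(2)[OF i] N.cdf_nondecreasing[of "g (j + 1)" a] unfolding e
        by (cases "a \<le> g (j + 1)") auto
      then have "cdf (M n) a \<le> cdf (M n) (g (j + 1))" by (rule M.cdf_nondecreasing)
      then show ?thesis using grid(1)[OF i] j d(1) unfolding e abs_less_iff by linarith
    next
      case False
      then have "real K \<le> real j + 1" by linarith
      then have "real K * d \<le> (real j + 1) * d" using d(1) by (intro mult_right_mono) auto
      then have "1 \<le> real j * d + d" unfolding d(2) by (simp add: algebra_simps)
      then show ?thesis using M.cdf_bounded_prob[of n a] j d(1) by linarith
    qed
    \<comment> \<open>The lower bound uses the quantile \<open>j - 1\<close>: its level is strictly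
      below \<open>cdf N a\<close>, which forces it to lie left of \<open>a\<close>, and it exists
      even when \<open>j = K\<close>. This loses up to \<open>3 * d\<close>.\<close>
    moreover have "cdf N a - 3 * d \<le> cdf (M n) a"
    proof (cases "1 < j")
      case True
      have "real j \<le> real K"
        using jr mult_left_mono[OF N.cdf_bounded_prob[of a], of "real K"] by simp
      then have i: "j - 1 \<in> {1..<K}" using True by auto
      have e: "real (j - 1) * d = real j * d - d" using True by (simp add: of_nat_diff algebra_simps)
      have "cdf N (g (j - 1)) < cdf N a" using j d(1) unfolding grid(2)[OF i] e by linarith
      then have "g (j - 1) \<le> a"
        using N.cdf_nondecreasing[of a "g (j - 1)"] by (cases "g (j - 1) \<le> a") auto
      then have "cdf (M n) (g (j - 1)) \<le> cdf (M n) a" by (rule M.cdf_nondecreasing)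
      then show ?thesis using grid(1)[OF i] j d(1) unfolding e abs_less_iff by linarith
    next
      case False
      then have "real j * d \<le> 1 * d" using d(1) by (intro mult_right_mono) auto
      then show ?thesis using j d(1) M.cdf_nonneg[of n a] by linarith
    qed
    ultimately show ?thesis unfolding abs_le_iff by linarith
  qed
  have dr: "3 * d < r"
  proof -
    have "3 < real K * r" using K r by (simp add: field_simps)
    then show ?thesis using K0 by (simp add: d_def field_simps)
  qed
  have "norm ((SUP a. \<bar>cdf (M n) a - cdf N a\<bar>) - 0) < r" if n: "n \<ge> n0" for n
  proof -
    have bdd: "bdd_above (range (\<lambda>a. \<bar>cdf (M n) a - cdf N a\<bar>))"
      using close[OF n] by (intro bdd_aboveI[of _ "3 * d"]) auto
    have "(SUP a. \<bar>cdf (M n) a - cdf N a\<bar>) \<le> 3 * d" by (intro cSUP_least) (auto simp: close[OF n])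
    moreover have "0 \<le> (SUP a. \<bar>cdf (M n) a - cdf N a\<bar>)"
      by (rule cSUP_upper2[OF bdd UNIV_I]) simp
    ultimately show ?thesis using dr by simp
  qed
  then show "\<exists>no. \<forall>n\<ge>no. norm ((SUP a. \<bar>cdf (M n) a - cdf N a\<bar>) - 0) < r" by blast
qed

lemma measure_std_normal:
  assumes "A \<in> sets borel"
  shows "measure std_normal_distribution A = (LBINT t:A. exp (- (t^2) / 2) / sqrt (2 * pi))"
proof -
  have "measure std_normal_distribution A = (\<integral>x. indicator A x \<partial>std_normal_distribution)"
    by simp
  also have "\<dots> = (\<integral>x. std_normal_density x *\<^sub>R indicator A x \<partial>lborel)"
    using assms by (intro integral_density) auto
  also have "\<dots> = (LBINT t:A. exp (- (t^2) / 2) / sqrt (2 * pi))"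
    unfolding set_lebesgue_integral_def
    by (intro Bochner_Integration.integral_cong) (auto simp: std_normal_density_def)
  finally show ?thesis .
qed

text \<open>A density with respect to Lebesgue measure gives no mass to points.\<close>

lemma isCont_cdf_std_normal: "isCont (cdf std_normal_distribution) x"
proof -
  interpret real_distribution std_normal_distribution by (rule real_dist_normal_dist)
  have "measure std_normal_distribution {x} = 0"
    unfolding measure_std_normal[OF borel_singleton[OF sets.empty_sets]] set_lebesgue_integral_def
    by (intro integral_eq_zero_AE AE_I[of _ _ "{x}"]) (auto simp: indicator_def)
  then show ?thesis by (simp add: isCont_cdf)
qed

section \<open>The additive degree-Kirchhoff index of the random chain\<close>

lemma expectation_two_valued:
  fixes f :: "'a \<Rightarrow> real"
  assumes "\<And>x. x \<in> set_pmf p \<Longrightarrow> f x = (if x \<in> A then \<alpha> else \<beta>)"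
  shows "measure_pmf.expectation p f = \<alpha> * measure_pmf.prob p A + \<beta> * (1 - measure_pmf.prob p A)"
proof -
  have "measure_pmf.expectation p f = measure_pmf.expectation p (\<lambda>x. \<beta> + (\<alpha> - \<beta>) * indicator A x)"
    using assms by (intro expectation_cong_pmf) auto
  also have "\<dots> = \<beta> + (\<alpha> - \<beta>) * measure_pmf.prob p A"
    by (subst Bochner_Integration.integral_add)
       (simp_all add: integrable_mult_right measure_pmf.integrable_const_bound[where B = 1])
  finally show ?thesis by (simp add: algebra_simps)
qed

section \<open>Weights, mean and variance in closed form\<close>

lemma sum_squared_products:
  "(\<Sum>i<k. ((real i + 1) * (x - real i))\<^sup>2) =
    x\<^sup>2 * (real k * (real k + 1) * (2 * real k + 1) / 6)
    - 2 * x * (real k ^ 2 * (real k + 1)\<^sup>2 / 4 - real k * (real k + 1) * (2 * real k + 1) / 6)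
    + (real k * (real k + 1) * (2 * real k + 1) * (3 * real k ^ 2 + 3 * real k - 1) / 30
       - real k ^ 2 * (real k + 1)\<^sup>2 / 2 + real k * (real k + 1) * (2 * real k + 1) / 6)"
\<comment> \<open>Keeping \<open>x\<close> independent of the summation bound makes the induction
  possible; the application takes both to be \<open>m\<close>. The three groups are the coefficients
  of \<open>x^2\<close>, \<open>x\<close> and 1, expressed by power sums.\<close>
proof (induction k)
  case (Suc k)
  show ?case
    unfolding sum.lessThan_Suc Suc.IH of_nat_Suc
    by (simp add: field_simps power2_eq_square)
qed simp

text \<open>With \<open>k = i + 2\<close> and \<open>n = m + 2\<close> this is
  \<open>120 * (k - 1) * (n - k)\<close>: \<open>m\<close> counts the random choices, and
  \<open>m + 1\<close> the bridges.\<close>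

definition kf_weight :: "nat \<Rightarrow> nat \<Rightarrow> real" where
  "kf_weight m i = 120 * ((real i + 1) * (real m - real i))"

definition centered :: "real \<Rightarrow> nat \<Rightarrow> real" where
  "centered p1 x = cycle_res 0 x - (4 / 5 * p1 + 6 / 5 * (1 - p1))"

definition kf_mean :: "real \<Rightarrow> nat \<Rightarrow> real" where
  "kf_mean p1 m = 40 + 163 * (real m + 1) + 143 * (real m + 1) ^ 2 + 20 * (real m + 1) ^ 3
    + (\<Sum>i<m. kf_weight m i * (4 / 5 * p1 + 6 / 5 * (1 - p1)))"

text \<open>The constant is \<open>480 * 4 / 25\<close>, and also \<open>48^2 / 30\<close>, the form
  in which it meets the stated polynomial.\<close>

definition kf_var :: "real \<Rightarrow> nat \<Rightarrow> real" where
  "kf_var p1 m = 384 / 5 * p1 * (1 - p1) * ((real m + 1) ^ 5 - (real m + 1))"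

lemma sum_kf_weight_squares: "(\<Sum>i<m. (kf_weight m i)\<^sup>2) = 480 * ((real m + 1) ^ 5 - (real m + 1))"
proof -
  have "(\<Sum>i<m. (kf_weight m i)\<^sup>2) = 14400 * (\<Sum>i<m. ((real i + 1) * (real m - real i))\<^sup>2)"
    by (simp add: kf_weight_def power_mult_distrib sum_distrib_left)
  also have "\<dots> = 480 * ((real m + 1) ^ 5 - (real m + 1))"
    unfolding sum_squared_products by (simp add: field_simps power2_eq_square eval_nat_numeral)
  finally show ?thesis .
qed

text \<open>\<open>q k\<close> is the law of the index of \<open>u_k\<close> in its pentagon, and
  \<open>{1, 4}\<close> are the neighbours of \<open>x_1\<close>, which has index 0. Only the
  probability of this class is fixed, so the split within each class is arbitrary; \<open>c0\<close>
  is the index of \<open>u_1\<close>.\<close>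

context
  fixes p1 :: real and c0 :: nat and q :: "nat \<Rightarrow> nat pmf"
  assumes p1: "0 < p1" "p1 < 1"
    and c0: "c0 < 5"
    and q_set: "\<And>k. k \<ge> 2 \<Longrightarrow> set_pmf (q k) \<subseteq> {1, 2, 3, 4}"
    and q_prob: "\<And>k. k \<ge> 2 \<Longrightarrow> measure_pmf.prob (q k) {1, 4} = p1"
begin

lemma q_finite: "\<forall>k\<ge>2. finite (set_pmf (q k))"
  using q_set by (meson finite.intros finite_subset)

lemma centered_q:
  assumes "k \<ge> 2" "x \<in> set_pmf (q k)"
  shows "centered p1 x = (if x \<in> {1, 4} then - (2 / 5) * (1 - p1) else 2 / 5 * p1)"
proof -
  have "x \<in> {1, 2, 3, 4}" using assms q_set by blast
  then show ?thesis by (auto simp: centered_def cycle_res_def field_simps)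
qed

text \<open>A centred Bernoulli variable scaled by the gap 2/5 between the two resistances.\<close>

lemma expectation_centered:
  assumes "k \<ge> 2"
  shows "measure_pmf.expectation (q k) (centered p1) = 0"
    and "measure_pmf.expectation (q k) (\<lambda>x. (centered p1 x)\<^sup>2) = 4 / 25 * p1 * (1 - p1)"
proof -
  show "measure_pmf.expectation (q k) (centered p1) = 0"
    using expectation_two_valued[of "q k", OF centered_q[OF assms]] unfolding q_prob[OF assms] by simp
  have "measure_pmf.expectation (q k) (\<lambda>x. (centered p1 x)\<^sup>2) =
      (- (2 / 5) * (1 - p1))\<^sup>2 * measure_pmf.prob (q k) {1, 4}
      + (2 / 5 * p1)\<^sup>2 * (1 - measure_pmf.prob (q k) {1, 4})"
    by (rule expectation_two_valued) (simp only: centered_q[OF assms] split: if_splits, simp)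
  also have "\<dots> = 4 / 25 * p1 * (1 - p1)"
    unfolding q_prob[OF assms] by (simp add: field_simps power2_eq_square)
  finally show "measure_pmf.expectation (q k) (\<lambda>x. (centered p1 x)\<^sup>2) = 4 / 25 * p1 * (1 - p1)" .
qed

lemma abs_centered_le:
  assumes "k \<ge> 2" "x \<in> set_pmf (q k)"
  shows "\<bar>centered p1 x\<bar> \<le> 1"
  unfolding centered_q[OF assms] using p1 by auto

lemma kf_pg_centered:
  assumes "xs \<in> set_pmf (rand_choices q m)"
  shows "kf_pg (m + 2) (c0 # xs) = kf_mean p1 m + (\<Sum>i<m. kf_weight m i * centered p1 (xs ! i))"
proof -
  have "(c0 # xs) ! k < 5" if "k < Suc m" for k
  proof (cases k)
    case (Suc i)
    then have "xs ! i \<in> {1, 2, 3, 4}"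
      using nth_rand_choices[OF assms, of i] q_set[of "i + 2"] that by auto
    then show ?thesis using Suc by auto
  qed (simp add: c0)
  then have "kf_pg (Suc (Suc m)) (c0 # xs) = 40 + 163 * real (Suc m) + 143 * real (Suc m) ^ 2 + 20 * real (Suc m) ^ 3
      + (\<Sum>i<Suc m. 120 * real i * (real (Suc m) - real i) * cycle_res 0 ((c0 # xs) ! i))"
    by (rule kf_pg_eq)
  \<comment> \<open>The head \<open>c0\<close> stands at index 0, where the factor
    \<open>real i\<close> is zero; the other indices shift down by one.\<close>
  also have "(\<Sum>i<Suc m. 120 * real i * (real (Suc m) - real i) * cycle_res 0 ((c0 # xs) ! i))
      = (\<Sum>i<m. kf_weight m i * cycle_res 0 (xs ! i))"
    unfolding sum.lessThan_Suc_shift by (simp add: kf_weight_def algebra_simps)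
  also have "\<dots> = (\<Sum>i<m. kf_weight m i * (4 / 5 * p1 + 6 / 5 * (1 - p1))) + (\<Sum>i<m. kf_weight m i * centered p1 (xs ! i))"
    unfolding sum.distrib[symmetric] centered_def by (simp add: algebra_simps)
  finally show ?thesis by (simp add: kf_mean_def add.commute)
qed

lemma expectation_pg_choices:
  fixes f :: "nat list \<Rightarrow> real"
  shows "measure_pmf.expectation (pg_choices c0 q (m + 2)) f =
    measure_pmf.expectation (rand_choices q m) (\<lambda>xs. f (c0 # xs))"
  by (simp add: pg_choices_def)

lemma centered_term_mean:
  "measure_pmf.expectation (q (i + 2)) (\<lambda>x. kf_weight m i * centered p1 x) = 0"
  by (simp add: expectation_centered)

lemma expectation_kf_pg:
  "measure_pmf.expectation (pg_choices c0 q (m + 2)) (kf_pg (m + 2)) = kf_mean p1 m"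
proof -
  have "measure_pmf.expectation (pg_choices c0 q (m + 2)) (kf_pg (m + 2)) =
      measure_pmf.expectation (rand_choices q m) (\<lambda>xs. kf_mean p1 m + (\<Sum>i<m. kf_weight m i * centered p1 (xs ! i)))"
    unfolding expectation_pg_choices by (intro expectation_cong_pmf kf_pg_centered)
  also have "\<dots> = kf_mean p1 m"
    using moments_rand_choices(1)[OF q_finite, of "\<lambda>i x. kf_weight m i * centered p1 x", OF centered_term_mean, of m]
    by (subst Bochner_Integration.integral_add)
       (auto intro!: integrable_measure_pmf_finite[OF finite_rand_choices[OF q_finite]]
          simp del: Bochner_Integration.integrable_sum Bochner_Integration.integral_sum)
  finally show ?thesis .
qed

lemma variance_kf_pg:
  "measure_pmf.variance (pg_choices c0 q (m + 2)) (kf_pg (m + 2)) = kf_var p1 m"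
proof -
  have "measure_pmf.variance (pg_choices c0 q (m + 2)) (kf_pg (m + 2)) =
      measure_pmf.expectation (rand_choices q m) (\<lambda>xs. (\<Sum>i<m. kf_weight m i * centered p1 (xs ! i))\<^sup>2)"
    unfolding expectation_kf_pg unfolding expectation_pg_choices
    by (intro expectation_cong_pmf) (simp only: kf_pg_centered add_diff_cancel_left')
  also have "\<dots> = (\<Sum>i<m. (kf_weight m i)\<^sup>2 * (4 / 25 * p1 * (1 - p1)))"
    unfolding moments_rand_choices(2)[OF q_finite, of "\<lambda>i x. kf_weight m i * centered p1 x", OF centered_term_mean]
    by (simp add: power_mult_distrib expectation_centered)
  also have "\<dots> = kf_var p1 m"
    unfolding sum_distrib_right[symmetric] sum_kf_weight_squares kf_var_def by simp
  finally show ?thesis .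
qed

lemma kf_var_lower: "384 / 5 * p1 * (1 - p1) * real m ^ 5 \<le> kf_var p1 m"
proof -
  have "real m ^ 5 \<le> (real m + 1) ^ 5 - (real m + 1)"
    by (simp add: eval_nat_numeral algebra_simps)
  then show ?thesis unfolding kf_var_def using p1 by (intro mult_left_mono) auto
qed

text \<open>Weights are at most of order \<open>m^2\<close> while the standard deviation is at least
  of order \<open>m^(5/2)\<close>, so the summands are uniformly of order \<open>m^(-1/2)\<close>
  and the central limit theorem applies.\<close>

lemma kf_pg_standardized_weak_conv:
  "weak_conv_m (\<lambda>m. distr (rand_choices q m) borel
      (\<lambda>xs. \<Sum>i<m. kf_weight m i * centered p1 (xs ! i) / sqrt (kf_var p1 m))) std_normal_distribution"
proof (rule clt_rand_choices[OF q_finite])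
  define C where "C = 384 / 5 * p1 * (1 - p1)"
  have C: "0 < C" using p1 by (simp add: C_def)
  \<comment> \<open>Nondegeneracy: \<open>C\<close> is positive because \<open>p1\<close> lies
    strictly between 0 and 1.\<close>
  have var_pos: "0 < kf_var p1 m" if "m \<ge> 1" for m
    using kf_var_lower[of m] C that unfolding C_def[symmetric]
    by (smt (verit) of_nat_0_less_iff zero_less_power mult_pos_pos less_le_trans zero_less_one)
  show "measure_pmf.expectation (q (i + 2)) (\<lambda>x. kf_weight m i * centered p1 x / sqrt (kf_var p1 m)) = 0" for m i
    by (simp add: expectation_centered)
  show "(\<Sum>i<m. measure_pmf.expectation (q (i + 2)) (\<lambda>x. (kf_weight m i * centered p1 x / sqrt (kf_var p1 m))\<^sup>2)) = 1"
    if "m \<ge> 1" for m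
  proof -
    have "(\<Sum>i<m. measure_pmf.expectation (q (i + 2)) (\<lambda>x. (kf_weight m i * centered p1 x / sqrt (kf_var p1 m))\<^sup>2))
        = (\<Sum>i<m. (kf_weight m i)\<^sup>2 * (4 / 25 * p1 * (1 - p1) / kf_var p1 m))"
      using var_pos[OF that] by (simp add: power_mult_distrib power_divide expectation_centered)
    also have "\<dots> = kf_var p1 m / kf_var p1 m"
      unfolding sum_distrib_right[symmetric] sum_kf_weight_squares
      unfolding times_divide_eq_right
      by (rule arg_cong[where f = "\<lambda>y. y / kf_var p1 m"]) (simp add: kf_var_def)
    finally show ?thesis using var_pos[OF that] by simp
  qed
  show "\<bar>kf_weight m i * centered p1 x / sqrt (kf_var p1 m)\<bar> \<le> 120 / sqrt (C * real m)"
    if "i < m" "x \<in> set_pmf (q (i + 2))" for m i x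
  proof -
    have m: "0 < real m" using that by simp
    have "(real i + 1) * (real m - real i) \<le> real m * real m"
      using that(1) by (intro mult_mono) auto
    then have c: "\<bar>kf_weight m i\<bar> \<le> 120 * (real m)\<^sup>2"
      using that(1) by (simp add: kf_weight_def abs_mult power2_eq_square)
    have "\<bar>kf_weight m i * centered p1 x\<bar> \<le> 120 * (real m)\<^sup>2 * 1"
      unfolding abs_mult using abs_centered_le[OF _ that(2)] c by (intro mult_mono) auto
    moreover have "sqrt (C * real m) * (real m)\<^sup>2 \<le> sqrt (kf_var p1 m)"
    proof -
      have "sqrt (C * real m) * (real m)\<^sup>2 = sqrt (C * real m ^ 5)"
        by (simp add: real_sqrt_mult eval_nat_numeral)
      also have "\<dots> \<le> sqrt (kf_var p1 m)"
        using kf_var_lower[of m] unfolding C_def by simp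
      finally show ?thesis .
    qed
    moreover have "0 < sqrt (C * real m) * (real m)\<^sup>2" using m C by simp
    ultimately have "\<bar>kf_weight m i * centered p1 x\<bar> / sqrt (kf_var p1 m)
        \<le> 120 * (real m)\<^sup>2 / (sqrt (C * real m) * (real m)\<^sup>2)"
      by (intro frac_le) auto
    also have "\<dots> = 120 / sqrt (C * real m)" using m by simp
    finally show ?thesis
      using var_pos[of m] that(1) by (simp add: abs_divide)
  qed
  have "filterlim (\<lambda>m. sqrt (C * real m)) at_top sequentially"
    using C by (intro filterlim_compose[OF sqrt_at_top] filterlim_tendsto_pos_mult_at_top[OF tendsto_const]
        filterlim_real_sequentially)
  then show "(\<lambda>m. 120 / sqrt (C * real m)) \<longlonglongrightarrow> 0"
    by (intro tendsto_divide_0[OF tendsto_const] filterlim_at_top_imp_at_infinity)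
qed

lemma prob_kf_pg_standardized:
  "measure_pmf.prob (pg_choices c0 q (m + 2))
     {cs. (kf_pg (m + 2) cs - measure_pmf.expectation (pg_choices c0 q (m + 2)) (kf_pg (m + 2)))
          / sqrt (measure_pmf.variance (pg_choices c0 q (m + 2)) (kf_pg (m + 2))) \<le> a}
   = cdf (distr (rand_choices q m) borel
      (\<lambda>xs. \<Sum>i<m. kf_weight m i * centered p1 (xs ! i) / sqrt (kf_var p1 m))) a"
proof -
  have "measure_pmf.prob (pg_choices c0 q (m + 2))
     {cs. (kf_pg (m + 2) cs - kf_mean p1 m) / sqrt (kf_var p1 m) \<le> a}
    = measure_pmf.prob (rand_choices q m) {xs. (kf_pg (m + 2) (c0 # xs) - kf_mean p1 m) / sqrt (kf_var p1 m) \<le> a}"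
    by (simp add: pg_choices_def vimage_def)
  also have "\<dots> = measure_pmf.prob (rand_choices q m)
     {xs. (\<Sum>i<m. kf_weight m i * centered p1 (xs ! i) / sqrt (kf_var p1 m)) \<le> a}"
    \<comment> \<open>The two events agree only on the support, where \<open>kf_pg_centered\<close>
      holds.\<close>
    by (intro measure_pmf.finite_measure_eq_AE)
       (auto simp: AE_measure_pmf_iff kf_pg_centered[simplified] sum_divide_distrib)
  also have "\<dots> = cdf (distr (rand_choices q m) borel
      (\<lambda>xs. \<Sum>i<m. kf_weight m i * centered p1 (xs ! i) / sqrt (kf_var p1 m))) a"
    by (simp add: cdf_def measure_distr vimage_def)
  finally show ?thesis unfolding expectation_kf_pg variance_kf_pg[unfolded expectation_kf_pg] .
qed

end

theorem theorem3p4: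
  fixes p1 :: real and c0 :: nat and q :: "nat \<Rightarrow> nat pmf"
  assumes p1: "0 < p1" "p1 < 1"
    and c0: "c0 < 5"
    and q_set: "\<And>k. k \<ge> 2 \<Longrightarrow> set_pmf (q k) \<subseteq> {1, 2, 3, 4}"
    and q_prob: "\<And>k. k \<ge> 2 \<Longrightarrow> measure_pmf.prob (q k) {1, 4} = p1"
  defines "s4 \<equiv> 216^2 * p1 + 264^2 * (1 - p1) - (216 * p1 + 264 * (1 - p1))^2"
    and "t4 \<equiv> 133^2 * p1 + 181^2 * (1 - p1) - (133 * p1 + 181 * (1 - p1))^2"
    and "r4 \<equiv> 216 * 133 * p1 + 264 * 181 * (1 - p1)
              - (216 * p1 + 264 * (1 - p1)) * (133 * p1 + 181 * (1 - p1))"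
  shows "(\<forall>n::nat. n \<ge> 1 \<longrightarrow>
           measure_pmf.variance (pg_choices c0 q n) (kf_pg n)
           = (s4 * real n ^ 5 - 5 * r4 * real n ^ 4 + 10 * t4 * real n ^ 3
              + (65 * r4 - 30 * s4 - 45 * t4) * real n ^ 2
              + (59 * s4 + 65 * t4 - 120 * r4) * real n
              + (60 * r4 - 30 * s4 - 30 * t4)) / 30)
       \<and> ((\<lambda>n::nat. SUP a::real. \<bar>measure_pmf.prob (pg_choices c0 q n)
              {cs. (kf_pg n cs - measure_pmf.expectation (pg_choices c0 q n) (kf_pg n))
                   / sqrt (measure_pmf.variance (pg_choices c0 q n) (kf_pg n)) \<le> a}
            - (LBINT t:{..a}. exp (- (t^2) / 2) / sqrt (2 * pi))\<bar>)
         \<longlonglongrightarrow> 0)"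
proof (intro conjI allI impI)
  note hyps = p1 c0 q_set q_prob
  \<comment> \<open>Both pairs 216, 264 and 133, 181 differ by 48, so the two variances and the
    covariance coincide.\<close>
  have same: "s4 = 2304 * (p1 * (1 - p1))" "t4 = 2304 * (p1 * (1 - p1))" "r4 = 2304 * (p1 * (1 - p1))"
    unfolding s4_def t4_def r4_def by (simp_all add: power2_eq_square algebra_simps)
  fix n :: nat assume "n \<ge> 1"
  then consider "n = 1" | m where "n = m + 2"
    by (metis One_nat_def add_2_eq_Suc' le_SucE less_eq_Suc_le not0_implies_Suc not_one_le_zero)
  then show "measure_pmf.variance (pg_choices c0 q n) (kf_pg n)
           = (s4 * real n ^ 5 - 5 * r4 * real n ^ 4 + 10 * t4 * real n ^ 3
              + (65 * r4 - 30 * s4 - 45 * t4) * real n ^ 2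
              + (59 * s4 + 65 * t4 - 120 * r4) * real n
              + (60 * r4 - 30 * s4 - 30 * t4)) / 30"
  proof cases
    case 1
    \<comment> \<open>For \<open>n = 1\<close> the truncated \<open>n - 2\<close> is 0, so the law
      is a point mass; the polynomial vanishes at 1.\<close>
    then show ?thesis unfolding same by (simp add: pg_choices_def)
  next
    case 2
    have "measure_pmf.variance (pg_choices c0 q n) (kf_pg n) = kf_var p1 m"
      unfolding 2 by (rule variance_kf_pg[OF hyps])
    also have "\<dots> = (s4 * real n ^ 5 - 5 * r4 * real n ^ 4 + 10 * t4 * real n ^ 3
              + (65 * r4 - 30 * s4 - 45 * t4) * real n ^ 2
              + (59 * s4 + 65 * t4 - 120 * r4) * real n
              + (60 * r4 - 30 * s4 - 30 * t4)) / 30"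
      \<comment> \<open>With equal constants the polynomial collapses to a multiple of
        \<open>(n - 1)^5 - (n - 1)\<close>.\<close>
      unfolding same kf_var_def 2 by (simp add: eval_nat_numeral field_simps)
    finally show ?thesis .
  qed
next
  note hyps = p1 c0 q_set q_prob
  let ?D = "\<lambda>m. distr (rand_choices q m) borel
      (\<lambda>xs. \<Sum>i<m. kf_weight m i * centered p1 (xs ! i) / sqrt (kf_var p1 m))"
  have conv: "(\<lambda>m. SUP a. \<bar>cdf (?D m) a - cdf std_normal_distribution a\<bar>) \<longlonglongrightarrow> 0"
    by (intro uniform_cdf_convergence prob_space.real_distribution_distr[OF prob_space_measure_pmf]
        real_dist_normal_dist isCont_cdf_std_normal kf_pg_standardized_weak_conv[OF hyps]) auto
  show "(\<lambda>n::nat. SUP a::real. \<bar>measure_pmf.prob (pg_choices c0 q n)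
              {cs. (kf_pg n cs - measure_pmf.expectation (pg_choices c0 q n) (kf_pg n))
                   / sqrt (measure_pmf.variance (pg_choices c0 q n) (kf_pg n)) \<le> a}
            - (LBINT t:{..a}. exp (- (t^2) / 2) / sqrt (2 * pi))\<bar>) \<longlonglongrightarrow> 0"
    \<comment> \<open>The limit is unaffected by a shift of the index, which matches
      \<open>n = m + 2\<close>.\<close>
    by (rule LIMSEQ_offset[where k = 2])
       (use conv in \<open>simp only: prob_kf_pg_standardized[OF hyps] cdf_def2[of std_normal_distribution]
          measure_std_normal[OF borel_closed[OF closed_atMost]]\<close>)
qed

end
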